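(* Let $m,n\ge 0$ with $p=2m+n>1$, and let $\mathcal{P}$ be the family of simple planar graphs. Then $$3p^2+p+1\le \omega_{r(m,n)}(\mathcal{P})\le 42p^2+8.$$
   Context: An $(m,n)$-colored mixed graph $G$ is obtained from a simple graph $U(G)$ (its underlying graph) by giving each edge either an orientation and one of $m$ arc colors (an arc) or leaving it unoriented with one of $n$ edge colors (an edge). For adjacent $u,v$, the adjacency type of $uv$ is "arc $u\to v$ of color $i$", "arc $v\to u$ of color $i$", or "edge of color $j$"; $uv$ and $wx$ have the same adjacency type if both are arcs $u\to v$, $w\to x$ of the same color, or both arcs $v\to u$, $x\to w$ of the same color, or both edges of the same color. A colored homomorphism $f:G\to H$ between $(m,n)$-colored mixed graphs (with simple underlying graphs) is a vertex map such that for each adjacent pair $uv$ of $G$, $f(u)f(v)$ is adjacent in $H$ with the same adjacency type. $R\subseteq V(G)$ is a relative $(m,n)$-clique if no two distinct vertices of $R$ have the same image under any colored homomorphism of $G$. $\omega_{r(m,n)}(G)$ is the maximum size of a relative $(m,n)$-clique of $G$; for a family $\mathcal{F}$ of simple graphs, $\omega_{r(m,n)}(\mathcal{F})$ is the maximum of $\omega_{r(m,n)}(G)$ over all $(m,n)$-colored mixed graphs $G$ with $U(G)\in\mathcal{F}$. A 2-path $uvw$ is special if $uv$ and $vw$ do not have the same adjacency type; it is known that two distinct vertices can never be identified by a colored homomorphism iff they are adjacent or joined by a special 2-path. *)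

theory Defs
  imports "HOL-Analysis.Analysis" "HOL-Library.Extended_Nat"
begin

text \<open>Adjacency type of an ordered adjacent pair (u,v):
  Fwd i = arc u -> v of colour i, Bwd i = arc v -> u of colour i, Edg j = edge of colour j.\<close>
datatype adjtype = Fwd nat | Bwd nat | Edg nat

fun flip_adj :: "adjtype \<Rightarrow> adjtype" where
  "flip_adj (Fwd i) = Bwd i"
| "flip_adj (Bwd i) = Fwd i"
| "flip_adj (Edg j) = Edg j"

text \<open>A mixed graph on vertex set V (vertices are natural numbers) is given by a labelling
  of ordered pairs; None means non-adjacent.\<close>
record mgraph =
  verts :: "nat set"
  lab :: "nat \<Rightarrow> nat \<Rightarrow> adjtype option"

definition colored_mixed_graph :: "nat \<Rightarrow> nat \<Rightarrow> mgraph \<Rightarrow> bool" where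
  "colored_mixed_graph m n G \<longleftrightarrow>
     finite (verts G) \<and>
     (\<forall>u v. lab G u v \<noteq> None \<longrightarrow> u \<in> verts G \<and> v \<in> verts G \<and> u \<noteq> v) \<and>
     (\<forall>u v. lab G v u = map_option flip_adj (lab G u v)) \<and>
     (\<forall>u v i. lab G u v = Some (Fwd i) \<longrightarrow> i < m) \<and>
     (\<forall>u v j. lab G u v = Some (Edg j) \<longrightarrow> j < n)"

definition underlying_edges :: "mgraph \<Rightarrow> nat set set" where
  "underlying_edges G = {{u, v} | u v. lab G u v \<noteq> None}"

definition colored_hom :: "mgraph \<Rightarrow> mgraph \<Rightarrow> (nat \<Rightarrow> nat) \<Rightarrow> bool" where
  "colored_hom G H f \<longleftrightarrow>
     f ` verts G \<subseteq> verts H \<and>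
     (\<forall>u v t. lab G u v = Some t \<longrightarrow> lab H (f u) (f v) = Some t)"

definition relative_clique :: "nat \<Rightarrow> nat \<Rightarrow> mgraph \<Rightarrow> nat set \<Rightarrow> bool" where
  "relative_clique m n G R \<longleftrightarrow>
     R \<subseteq> verts G \<and>
     (\<forall>H f. colored_mixed_graph m n H \<and> colored_hom G H f \<longrightarrow> inj_on f R)"

definition omega_r :: "nat \<Rightarrow> nat \<Rightarrow> mgraph \<Rightarrow> nat" where
  "omega_r m n G = Max {card R | R. relative_clique m n G R}"

definition simple_graph :: "nat set \<Rightarrow> nat set set \<Rightarrow> bool" where
  "simple_graph V E \<longleftrightarrow> finite V \<and> (\<forall>e\<in>E. \<exists>u v. u \<noteq> v \<and> u \<in> V \<and> v \<in> V \<and> e = {u, v})"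

definition planar :: "nat set \<Rightarrow> nat set set \<Rightarrow> bool" where
  "planar V E \<longleftrightarrow> simple_graph V E \<and>
     (\<exists>(pos :: nat \<Rightarrow> real^2) (\<gamma> :: nat set \<Rightarrow> real \<Rightarrow> real^2).
        inj_on pos V \<and>
        (\<forall>e\<in>E. arc (\<gamma> e) \<and> {pathstart (\<gamma> e), pathfinish (\<gamma> e)} = pos ` e \<and>
                 path_image (\<gamma> e) \<inter> pos ` V \<subseteq> pos ` e) \<and>
        (\<forall>e\<in>E. \<forall>e'\<in>E. e \<noteq> e' \<longrightarrow>
                 path_image (\<gamma> e) \<inter> path_image (\<gamma> e') \<subseteq> pos ` (e \<inter> e')))"

definition omega_r_planar :: "nat \<Rightarrow> nat \<Rightarrow> enat" where
  "omega_r_planar m n =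
     (SUP G \<in> {G. colored_mixed_graph m n G \<and> planar (verts G) (underlying_edges G)}.
        enat (omega_r m n G))"

end

theory Submission
  imports Defs
begin

text \<open>
  Upper bound. The only topological input is that a planar graph has no \<open>K\<^sub>3\<^sub>,\<^sub>3\<close> minor. Two distinct
  vertices of a relative clique \<open>R\<close> are adjacent or are joined by a special 2-path. Excluding \<open>K\<^sub>3\<^sub>,\<^sub>3\<close>
  forces at most \<open>5 p + 7\<close> vertices of \<open>R\<close> to have the same adjacency type towards a fixed vertex, so a
  vertex with \<open>d\<close> neighbours in \<open>R\<close> joins at most \<open>d q\<close> ordered pairs, where \<open>q = (p - 1) (5 p + 7)\<close>.
  A graph without \<open>K\<^sub>3\<^sub>,\<^sub>3\<close> minor on \<open>N\<close> vertices has fewer than \<open>4 N\<close> edges; hence the vertices of \<open>R\<close>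
  together with the outer vertices having at least five neighbours in \<open>R\<close> join at most \<open>8 q |R|\<close> ordered
  pairs. An outer vertex with at most four neighbours is replaced by cliques on at most three of them (a
  Y-Delta move, which creates no \<open>K\<^sub>3\<^sub>,\<^sub>3\<close> minor), and three such replacements account for the remaining
  \<open>24 |R|\<close> ordered pairs. Comparing with \<open>|R| (|R| - 1)\<close> gives \<open>|R| \<le> 8 q + 25 \<le> 42 p\<^sup>2 + 8\<close>.

  Lower bound. A vertex joined to everything, over \<open>p\<close> disjoint fans with \<open>3 p + 1\<close> vertices each, is drawn
  with straight lines: the fans have their vertices on a parabola, the apex lies far below it.
\<close>

text \<open>The number of outer vertices is not controlled by \<open>R\<close>, so the pairs joined
  through them cannot be counted one centre at a time. The edge bound decides the split: on
  \<open>R\<close> and the outer vertices it charges 8 per outer vertex and credits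
  \<open>2 d\<close> for its \<open>d\<close> neighbours in \<open>R\<close>. From
  \<open>d = 5\<close> on, the credit exceeds the charge and also pays for the pairs; at
  \<open>d <= 4\<close> it does not, and the Y-Delta move takes over. That move is limited to three
  leaves: four leaves could stand for two disjoint adjacencies between branch sets, while one centre
  joins only one branch set.

  For \<open>p >= 2\<close> the number \<open>5 p + 7\<close> dominates both outcomes of the
  same-type analysis, 17 and \<open>5 p + 1\<close>. The bound \<open>8 q + 25\<close> equals
  \<open>40 p^2 + 16 p - 31\<close>; the extra \<open>2 p^2\<close> absorbs the linear term.

  In the lower bound a hub separates \<open>p\<close> types, and a special 2-path separates the ends
  of a triple of equal type, so a hub serves \<open>3 p\<close> vertices. The apex separates
  \<open>p\<close> such blocks: \<open>p (3 p + 1) + 1\<close> vertices.\<close>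

section \<open>Planar drawings contain no \<open>K\<^sub>3\<^sub>,\<^sub>3\<close> minor\<close>

text \<open>A point \<open>x\<close> on the side of \<open>c1 \<union> c2\<close> avoiding \<open>q\<close> is not separated from \<open>q\<close> by \<open>c1 \<union> c3\<close> or by
  \<open>c2 \<union> c3\<close>. These meet in the connected set \<open>c3\<close>, so Janiszewski's theorem contradicts the choice of \<open>x\<close>.\<close>

lemma theta_curve_obstruction:
  fixes c1 c2 c3 :: "real \<Rightarrow> complex"
  assumes c1: "arc c1" "pathstart c1 = a" "pathfinish c1 = b"
    and c2: "arc c2" "pathstart c2 = a" "pathfinish c2 = b"
    and c3: "arc c3" "pathstart c3 = a" "pathfinish c3 = b"
    and c12: "path_image c1 \<inter> path_image c2 = {a,b}"
    and c13: "path_image c1 \<inter> path_image c3 = {a,b}"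
    and c23: "path_image c2 \<inter> path_image c3 = {a,b}"
    and Q1: "connected Q1" "q \<in> Q1" "Q1 \<inter> path_image c1 \<noteq> {}"
      "Q1 \<inter> path_image c2 = {}" "Q1 \<inter> path_image c3 = {}"
    and Q2: "connected Q2" "q \<in> Q2" "Q2 \<inter> path_image c2 \<noteq> {}"
      "Q2 \<inter> path_image c1 = {}" "Q2 \<inter> path_image c3 = {}"
    and Q3: "connected Q3" "q \<in> Q3" "Q3 \<inter> path_image c3 \<noteq> {}"
      "Q3 \<inter> path_image c1 = {}" "Q3 \<inter> path_image c2 = {}"
  shows False
proof -
  let ?P1 = "path_image c1" and ?P2 = "path_image c2" and ?P3 = "path_image c3"
  define c where "c = c1 +++ reversepath c2"
  have pc: "path_image c = ?P1 \<union> ?P2"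
    unfolding c_def using c1 c2 by (simp add: path_image_join)
  have "simple_path c"
    unfolding c_def
    by (rule simple_path_join_loop) (use c1 c2 c12 in \<open>auto simp: arc_reversepath\<close>)
  moreover have "pathfinish c = pathstart c"
    unfolding c_def using c1 c2 by simp
  ultimately have J: "inside (path_image c) \<noteq> {}" "open (inside (path_image c))"
    "connected (inside (path_image c))" "outside (path_image c) \<noteq> {}"
    "open (outside (path_image c))" "connected (outside (path_image c))"
    "inside (path_image c) \<inter> outside (path_image c) = {}"
    "inside (path_image c) \<union> outside (path_image c) = - path_image c"
    "frontier (inside (path_image c)) = path_image c"
    "frontier (outside (path_image c)) = path_image c"
    using Jordan_inside_outside[of c] by auto
  have qn: "q \<notin> path_image c" using pc Q3 by auto
  \<comment> \<open>\<open>W'\<close> is the side that holds \<open>q\<close>; the rest does not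
    depend on whether this is the inside or the outside.\<close>
  obtain W W' where W: "W \<noteq> {}" "open W" "connected W" "open W'" "W \<inter> W' = {}"
      "W \<union> W' = - path_image c" "frontier W = path_image c" "q \<in> W'"
  proof (cases "q \<in> inside (path_image c)")
    case True
    show ?thesis
      by (rule that[of "outside (path_image c)" "inside (path_image c)"]) ((use J True in blast)+)
  next
    case False
    show ?thesis
      by (rule that[of "inside (path_image c)" "outside (path_image c)"]) ((use J False qn in blast)+)
  qed
  have endless: "connected (path_image d - {a,b})" if "arc d" "pathstart d = a" "pathfinish d = b"
    for d :: "real \<Rightarrow> complex"
    using connected_simple_path_endless[of d] that by (auto simp: arc_imp_simple_path)
  have ab: "a \<in> ?P1" "b \<in> ?P1" "a \<in> ?P2" "b \<in> ?P2" "a \<in> ?P3" "b \<in> ?P3"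
    using c12 c23 by auto
  have side: "S \<inter> W = {}" if "connected S" "q \<in> S" "S \<inter> path_image c = {}" for S
  proof (rule ccontr)
    assume "S \<inter> W \<noteq> {}"
    moreover have "S \<subseteq> W \<union> W'" using that W by blast
    moreover have "S \<inter> W' \<noteq> {}" using that W by blast
    moreover have "W \<inter> W' \<inter> S = {}" using W by blast
    ultimately show False
      using connectedD[OF that(1) W(2) W(4)] by blast
  qed
  \<comment> \<open>\<open>Q3\<close> ties the open third arc to the side of \<open>q\<close>, so
    \<open>W\<close> misses all three arcs.\<close>
  have "connected (Q3 \<union> (?P3 - {a,b}))"
    by (rule connected_Un[OF Q3(1) endless[OF c3]]) (use Q3 ab in auto)
  then have "(Q3 \<union> (?P3 - {a,b})) \<inter> W = {}"
    by (rule side) (use Q3 c13 c23 pc in auto)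
  then have W3: "W \<inter> ?P3 = {}"
    using W pc ab by blast
  have W12: "W \<inter> ?P1 = {}" "W \<inter> ?P2 = {}" using W pc by blast+
  obtain x where x: "x \<in> W" using W by blast
  have clW: "?P1 \<subseteq> closure W" "?P2 \<subseteq> closure W"
    using W(7) pc by (auto simp: frontier_def)
  \<comment> \<open>Both arcs lie in the frontier of \<open>W\<close>, so adding an open arc keeps
    \<open>W\<close> connected and opens a way to \<open>Q1\<close> or \<open>Q2\<close>.\<close>
  have Wcl: "connected (W \<union> (?P1 - {a,b}))" "connected (W \<union> (?P2 - {a,b}))"
    by (rule connected_intermediate_closure[OF W(3)]; use clW closure_subset[of W] in blast)+
  have "connected (W \<union> (?P2 - {a,b}) \<union> Q2)"
    by (rule connected_Un[OF Wcl(2) Q2(1)]) (use Q2 ab in auto)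
  moreover have "W \<union> (?P2 - {a,b}) \<union> Q2 \<subseteq> - (?P1 \<union> ?P3)"
    using W3 W12 Q2 c12 c23 by auto
  ultimately have cc13: "connected_component (- (?P1 \<union> ?P3)) x q"
    unfolding connected_component_def using x Q2 by blast
  have "connected (W \<union> (?P1 - {a,b}) \<union> Q1)"
    by (rule connected_Un[OF Wcl(1) Q1(1)]) (use Q1 ab in auto)
  moreover have "W \<union> (?P1 - {a,b}) \<union> Q1 \<subseteq> - (?P2 \<union> ?P3)"
    using W3 W12 Q1 c12 c13 by auto
  ultimately have cc23: "connected_component (- (?P2 \<union> ?P3)) x q"
    unfolding connected_component_def using x Q1 by blast
  have "(?P1 \<union> ?P3) \<inter> (?P2 \<union> ?P3) = ?P3" using c12 ab by auto
  then have "connected ((?P1 \<union> ?P3) \<inter> (?P2 \<union> ?P3))"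
    using c3 by (simp add: connected_path_image arc_imp_path)
  moreover have "compact (?P1 \<union> ?P3)" "closed (?P2 \<union> ?P3)"
    using c1 c2 c3 by (auto simp: compact_Un compact_path_image arc_imp_path intro!: compact_imp_closed)
  ultimately have "connected_component (- ((?P1 \<union> ?P3) \<union> (?P2 \<union> ?P3))) x q"
    using Janiszewski cc13 cc23 by blast
  then obtain S where "connected S" "S \<subseteq> - ((?P1 \<union> ?P3) \<union> (?P2 \<union> ?P3))" "x \<in> S" "q \<in> S"
    unfolding connected_component_def by blast
  with side[of S] x pc show False by blast
qed

text \<open>Stop a path from \<open>x2\<close> at its first point on an arc from \<open>x0\<close>
  to \<open>x1\<close>: that point \<open>a\<close> cuts the arc into two legs, and the stopped path
  is the third. A branch set can thus act as a hub \<open>a\<close> with three ways out that meet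
  only there.\<close>

lemma path_connected_tripod:
  fixes A :: "'a::{complete_space,real_normed_vector} set"
  assumes A: "path_connected A" and x: "x0 \<in> A" "x1 \<in> A" "x2 \<in> A"
  obtains a T0 T1 T2 where "path_connected T0" "path_connected T1" "path_connected T2"
    "T0 \<subseteq> A" "T1 \<subseteq> A" "T2 \<subseteq> A" "x0 \<in> T0" "x1 \<in> T1" "x2 \<in> T2"
    "T0 \<inter> T1 = {a}" "T0 \<inter> T2 = {a}" "T1 \<inter> T2 = {a}"
proof (cases "x0 = x1")
  case True
  \<comment> \<open>Without an arc, two legs degenerate to the point \<open>x0\<close> and the third
    may be all of \<open>A\<close>.\<close>
  show thesis
    by (rule that[of "{x0}" "{x0}" A x0]) (use True x A in auto)
next
  case False
  then obtain s where s: "arc s" "path_image s \<subseteq> A" "pathstart s = x0" "pathfinish s = x1"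
    using A x unfolding path_connected_arcwise by blast
  obtain h where h: "path h" "path_image h \<subseteq> A" "pathstart h = x2" "pathfinish h = x0"
    using A x unfolding path_connected_def by blast
  \<comment> \<open>The times at which \<open>h\<close> is on the arc. Compactness yields the
    earliest one, \<open>t0\<close>; time 1 qualifies because \<open>h\<close> ends at
    \<open>x0\<close>.\<close>
  define K where "K = {0..1} \<inter> h -` path_image s"
  have ch: "continuous_on {0..1} h" and cs: "continuous_on {0..1} s"
    using h s by (auto simp: path_def arc_def)
  have "closed K"
    unfolding K_def
    by (rule continuous_closed_preimage) (use ch s in \<open>auto simp: closed_arc_image\<close>)
  then have "compact K"
    unfolding K_def by (metis Int_commute closed_Int_compact compact_Icc inf.left_idem)
  moreover have "1 \<in> K"
    unfolding K_def using h s by (metis Int_iff atLeastAtMost_iff order_refl pathfinish_def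
        pathstart_in_path_image vimage_eq zero_le_one)
  ultimately obtain t0 where t0: "t0 \<in> K" "\<And>t. t \<in> K \<Longrightarrow> t0 \<le> t"
    by (metis compact_attains_inf empty_iff)
  then have t01: "0 \<le> t0" "t0 \<le> 1" by (auto simp: K_def)
  obtain s0 where s0: "0 \<le> s0" "s0 \<le> 1" "h t0 = s s0"
    using t0(1) by (auto simp: K_def path_image_def)
  have inj: "inj_on s {0..1}" using s by (auto simp: arc_def)
  show thesis
  proof (rule that[of "s ` {0..s0}" "s ` {s0..1}" "h ` {0..t0}" "h t0"])
    show "path_connected (s ` {0..s0})" "path_connected (s ` {s0..1})" "path_connected (h ` {0..t0})"
      using s0 t01
      by (auto intro!: path_connected_continuous_image intro: continuous_on_subset[OF cs]
          continuous_on_subset[OF ch] simp: convex_imp_path_connected)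
    show "s ` {0..s0} \<subseteq> A" "s ` {s0..1} \<subseteq> A" "h ` {0..t0} \<subseteq> A"
      using s h s0 t01 by (auto simp: path_image_def image_subset_iff)
    show "x0 \<in> s ` {0..s0}" "x1 \<in> s ` {s0..1}" "x2 \<in> h ` {0..t0}"
      using s h s0 t01 by (auto simp: pathstart_def pathfinish_def image_iff)
    have hs: "h t \<notin> path_image s" if "0 \<le> t" "t < t0" for t
      using t0(2)[of t] that t01 by (auto simp: K_def)
    have "s u = s s0" if "0 \<le> u" "u \<le> s0" "s0 \<le> u'" "u' \<le> 1" "s u = s u'" for u u'
    proof -
      have "u = u'" using that s0 by (intro inj_onD[OF inj that(5)]) auto
      then show ?thesis using that by (metis order_antisym)
    qed
    then show "s ` {0..s0} \<inter> s ` {s0..1} = {h t0}"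
      using s0 by (force simp: image_iff)
    show "s ` {0..s0} \<inter> h ` {0..t0} = {h t0}"
    proof -
      have "h t = h t0" if "0 \<le> t" "t \<le> t0" "s u = h t" "0 \<le> u" "u \<le> s0" for t u
      proof -
        have "u \<in> {0..1}" using that s0 by auto
        then have "h t \<in> path_image s" unfolding path_image_def using that(3) by (metis imageI)
        with hs[of t] that show ?thesis by force
      qed
      then have "s ` {0..s0} \<inter> h ` {0..t0} \<subseteq> {h t0}" by (auto 4 4)
      moreover have "h t0 \<in> h ` {0..t0}" using t01 by simp
      moreover have "h t0 \<in> s ` {0..s0}" using s0 by simp
      ultimately show ?thesis by blast
    qed
    show "s ` {s0..1} \<inter> h ` {0..t0} = {h t0}"
    proof -
      have "h t = h t0" if "0 \<le> t" "t \<le> t0" "s u = h t" "s0 \<le> u" "u \<le> 1" for t u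
      proof -
        have "u \<in> {0..1}" using that s0 by auto
        then have "h t \<in> path_image s" unfolding path_image_def using that(3) by (metis imageI)
        with hs[of t] that show ?thesis by force
      qed
      then have "s ` {s0..1} \<inter> h ` {0..t0} \<subseteq> {h t0}" by (auto 4 4)
      moreover have "h t0 \<in> h ` {0..t0}" using t01 by simp
      moreover have "h t0 \<in> s ` {s0..1}" using s0 by simp
      ultimately show ?thesis by blast
    qed
  qed
qed

text \<open>Tripods turn \<open>A 0\<close> and \<open>A 1\<close> into hubs \<open>a\<close> and
  \<open>b\<close>. Going from \<open>a\<close> through \<open>B j\<close> to \<open>b\<close> gives
  three arcs that meet only in \<open>a\<close> and \<open>b\<close>, while \<open>A 2\<close> with
  its links reaches every \<open>B j\<close>: the configuration excluded by
  \<open>theta_curve_obstruction\<close>.\<close>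

lemma no_planar_K33_of_continua:
  fixes A B :: "nat \<Rightarrow> complex set" and g :: "nat \<Rightarrow> nat \<Rightarrow> real \<Rightarrow> complex"
  assumes A: "\<And>i. i < 3 \<Longrightarrow> path_connected (A i) \<and> closed (A i)"
    and B: "\<And>j. j < 3 \<Longrightarrow> path_connected (B j)"
    and AA: "\<And>i k. i < 3 \<Longrightarrow> k < 3 \<Longrightarrow> i \<noteq> k \<Longrightarrow> A i \<inter> A k = {}"
    and BB: "\<And>i k. i < 3 \<Longrightarrow> k < 3 \<Longrightarrow> i \<noteq> k \<Longrightarrow> B i \<inter> B k = {}"
    and AB: "\<And>i k. i < 3 \<Longrightarrow> k < 3 \<Longrightarrow> A i \<inter> B k = {}"
    and g: "\<And>i j. i < 3 \<Longrightarrow> j < 3 \<Longrightarrow> arc (g i j) \<and> pathstart (g i j) \<in> A i \<and> pathfinish (g i j) \<in> B j"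
    and gA: "\<And>i j k. i < 3 \<Longrightarrow> j < 3 \<Longrightarrow> k < 3 \<Longrightarrow> path_image (g i j) \<inter> A k \<subseteq> {pathstart (g i j)}"
    and gB: "\<And>i j k. i < 3 \<Longrightarrow> j < 3 \<Longrightarrow> k < 3 \<Longrightarrow> path_image (g i j) \<inter> B k \<subseteq> {pathfinish (g i j)}"
    and gg: "\<And>i j k l. i < 3 \<Longrightarrow> j < 3 \<Longrightarrow> k < 3 \<Longrightarrow> l < 3 \<Longrightarrow> (i,j) \<noteq> (k,l) \<Longrightarrow>
        path_image (g i j) \<inter> path_image (g k l) \<subseteq> {pathstart (g i j), pathfinish (g i j)}"
  shows False
proof -
  let ?G = "\<lambda>i j. path_image (g i j)"
  have start: "pathstart (g i j) \<in> A i" and finish: "pathfinish (g i j) \<in> B j"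
    if "i < 3" "j < 3" for i j using g that by auto
  have pcG: "path_connected (?G i j)" and clG: "closed (?G i j)" if "i < 3" "j < 3" for i j
    using g[OF that] by (auto simp: arc_imp_path path_connected_path_image closed_arc_image)
  have GA: "?G i j \<inter> A k = {}" if "i < 3" "j < 3" "k < 3" "k \<noteq> i" for i j k
    using gA[of i j k] start[of i j] AA[of i k] that by blast
  have GB: "?G i j \<inter> B k = {}" if "i < 3" "j < 3" "k < 3" "k \<noteq> j" for i j k
    using gB[of i j k] finish[of i j] BB[of j k] that by blast
  have GG1: "?G i j \<inter> ?G k l = {}" if "i < 3" "j < 3" "k < 3" "l < 3" "i \<noteq> k" "j \<noteq> l" for i j k l
  proof -
    have "?G i j \<inter> ?G k l \<subseteq> {pathstart (g i j), pathfinish (g i j)}" using gg[of i j k l] that by auto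
    moreover have "pathstart (g i j) \<notin> ?G k l" using start[of i j] GA[of k l i] that by blast
    moreover have "pathfinish (g i j) \<notin> ?G k l" using finish[of i j] GB[of k l j] that by blast
    ultimately show ?thesis by blast
  qed
  have GG2: "?G i j \<inter> ?G i l \<subseteq> A i" if "i < 3" "j < 3" "l < 3" "j \<noteq> l" for i j l
  proof -
    have "?G i j \<inter> ?G i l \<subseteq> {pathstart (g i j), pathfinish (g i j)}" using gg[of i j i l] that by auto
    moreover have "pathfinish (g i j) \<notin> ?G i l" using finish[of i j] GB[of i l j] that by blast
    ultimately show ?thesis using start[of i j] that by blast
  qed
  have GG3: "?G i j \<inter> ?G k j \<subseteq> B j" if "i < 3" "j < 3" "k < 3" "i \<noteq> k" for i j k
  proof -
    have "?G i j \<inter> ?G k j \<subseteq> {pathstart (g i j), pathfinish (g i j)}" using gg[of i j k j] that by auto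
    moreover have "pathstart (g i j) \<notin> ?G k j" using start[of i j] GA[of k j i] that by blast
    ultimately show ?thesis using finish[of i j] that by blast
  qed
  have tripod: "\<exists>a T. a \<in> A i \<and> (\<forall>j<3. path_connected (T j) \<and> T j \<subseteq> A i \<union> ?G i j \<and>
      a \<in> T j \<and> pathfinish (g i j) \<in> T j) \<and> (\<forall>j<3. \<forall>k<3. j \<noteq> k \<longrightarrow> T j \<inter> T k = {a})"
    if i: "i < 3" for i
  proof -
    have p: "path_connected (A i)" "pathstart (g i 0) \<in> A i" "pathstart (g i 1) \<in> A i"
      "pathstart (g i 2) \<in> A i"
      using A start i by auto
    obtain a T0 T1 T2 where T: "path_connected T0" "path_connected T1" "path_connected T2"
      "T0 \<subseteq> A i" "T1 \<subseteq> A i" "T2 \<subseteq> A i"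
      "pathstart (g i 0) \<in> T0" "pathstart (g i 1) \<in> T1" "pathstart (g i 2) \<in> T2"
      "T0 \<inter> T1 = {a}" "T0 \<inter> T2 = {a}" "T1 \<inter> T2 = {a}"
      by (rule path_connected_tripod[OF p])
    define T' where "T' = (\<lambda>j::nat. if j = 0 then T0 else if j = 1 then T1 else T2)"
    have T': "path_connected (T' j)" "T' j \<subseteq> A i" "pathstart (g i j) \<in> T' j" if "j < 3" for j
      using T that by (auto simp: T'_def less_Suc_eq numeral_eq_Suc)
    have T'i: "T' j \<inter> T' k = {a}" if "j < 3" "k < 3" "j \<noteq> k" for j k
      using T that by (auto simp: T'_def less_Suc_eq numeral_eq_Suc Int_commute)
    have aT': "a \<in> T' j" if "j < 3" for j
      using T that by (auto simp: T'_def)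
    define T where "T = (\<lambda>j. T' j \<union> ?G i j)"
    have 1: "path_connected (T j)" if "j < 3" for j
      unfolding T_def
      by (rule path_connected_Un) (use T'(1,3)[OF that] pcG[OF i that] pathstart_in_path_image[of "g i j"] in blast)+
    have 2: "T j \<inter> T k = {a}" if "j < 3" "k < 3" "j \<noteq> k" for j k
    proof -
      have "?G i j \<inter> A i \<subseteq> {pathstart (g i j)}" "?G i k \<inter> A i \<subseteq> {pathstart (g i k)}"
        using gA i that by auto
      moreover have "?G i j \<inter> ?G i k \<subseteq> A i" using GG2 i that by blast
      ultimately show ?thesis
        unfolding T_def using T'[of j] T'[of k] T'i[of j k] that by blast
    qed
    have 3: "T j \<subseteq> A i \<union> ?G i j" "a \<in> T j" "pathfinish (g i j) \<in> T j" if "j < 3" for j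
      using T'(2)[OF that] aT'[OF that] by (auto simp: T_def)
    have "a \<in> A i" using T'(2)[of 0] aT'[of 0] by auto
    then show ?thesis using 1 2 3 by blast
  qed
  have lt: "(0::nat) < 3" "(1::nat) < 3" by auto
  obtain a T where aA: "a \<in> A 0"
    and T0: "\<forall>j<3. path_connected (T j) \<and> T j \<subseteq> A 0 \<union> ?G 0 j \<and> a \<in> T j \<and> pathfinish (g 0 j) \<in> T j"
    and TT0: "\<forall>j<3. \<forall>k<3. j \<noteq> k \<longrightarrow> T j \<inter> T k = {a}"
    using tripod[OF lt(1)] by (elim exE conjE)
  obtain b U where bA: "b \<in> A 1"
    and U0: "\<forall>j<3. path_connected (U j) \<and> U j \<subseteq> A 1 \<union> ?G 1 j \<and> b \<in> U j \<and> pathfinish (g 1 j) \<in> U j"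
    and UU0: "\<forall>j<3. \<forall>k<3. j \<noteq> k \<longrightarrow> U j \<inter> U k = {b}"
    using tripod[OF lt(2)] by (elim exE conjE)
  note T = T0[rule_format] and TT = TT0[rule_format] and U = U0[rule_format] and UU = UU0[rule_format]
  define S where "S = (\<lambda>j. T j \<union> B j \<union> U j)"
  have ab: "a \<noteq> b" using aA bA AA[of 0 1] by auto
  have TU: "(A 0 \<union> ?G 0 j) \<inter> (A 1 \<union> ?G 1 k) \<subseteq> (if j = k then B j else {})" if "j < 3" "k < 3" for j k
    using AA[of 0 1] GA[of 0 j 1] GA[of 1 k 0] GG1[of 0 j 1 k] GG3[of 0 j 1] that by auto
  have TB: "(A i \<union> ?G i j) \<inter> B k = {}" if "i < 3" "j < 3" "k < 3" "j \<noteq> k" for i j k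
    using AB[of i k] GB[of i j k] that by blast
  have SS: "S j \<inter> S k = {a,b}" if "j < 3" "k < 3" "j \<noteq> k" for j k
  proof -
    have T': "T j \<subseteq> A 0 \<union> ?G 0 j" "T k \<subseteq> A 0 \<union> ?G 0 k" and U': "U j \<subseteq> A 1 \<union> ?G 1 j" "U k \<subseteq> A 1 \<union> ?G 1 k"
      using T that U by auto
    have kj: "k < 3" "j < 3" "k \<noteq> j" using that by auto
    have "T j \<inter> B k = {}" using T'(1) TB[OF lt(1) that] by blast
    moreover have "T k \<inter> B j = {}" using T'(2) TB[OF lt(1) kj] by blast
    moreover have "U j \<inter> B k = {}" using U'(1) TB[OF lt(2) that] by blast
    moreover have "U k \<inter> B j = {}" using U'(2) TB[OF lt(2) kj] by blast
    moreover have "T j \<inter> U k = {}" using T'(1) U'(2) TU[OF that(1,2)] that(3) by (auto split: if_splits)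
    moreover have "T k \<inter> U j = {}" using T'(2) U'(1) TU[OF kj(1,2)] kj(3) by (auto split: if_splits)
    moreover have "S j \<inter> S k = (T j \<inter> T k) \<union> (T j \<inter> B k) \<union> (T j \<inter> U k) \<union> (T k \<inter> B j) \<union> (B j \<inter> B k) \<union>
        (U k \<inter> B j) \<union> (T k \<inter> U j) \<union> (U j \<inter> B k) \<union> (U j \<inter> U k)"
      unfolding S_def by blast
    ultimately show ?thesis
      using TT[OF that] UU[OF that] BB[OF that] by auto
  qed
  have "\<exists>c. arc c \<and> path_image c \<subseteq> S j \<and> pathstart c = a \<and> pathfinish c = b" if "j < 3" for j
  proof -
    have "path_connected (S j)"
      unfolding S_def
      by (intro path_connected_Un) (use T[OF that] U[OF that] B[OF that] finish[of 0 j] finish[of 1 j] that in auto)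
    moreover have "a \<in> S j" "b \<in> S j" using T U that by (auto simp: S_def)
    ultimately show ?thesis using ab unfolding path_connected_arcwise by blast
  qed
  then obtain c where c: "\<And>j. j < 3 \<Longrightarrow> arc (c j) \<and> path_image (c j) \<subseteq> S j \<and> pathstart (c j) = a \<and> pathfinish (c j) = b"
    by metis
  have abc: "{a,b} \<subseteq> path_image (c j)" if "j < 3" for j
    using c[OF that] pathstart_in_path_image[of "c j"] pathfinish_in_path_image[of "c j"] by auto
  have cc: "path_image (c j) \<inter> path_image (c k) = {a,b}" if "j < 3" "k < 3" "j \<noteq> k" for j k
    using SS[OF that] c[OF that(1)] c[OF that(2)] abc[OF that(1)] abc[OF that(2)] by blast
  define Q where "Q = (\<lambda>j. A 2 \<union> ?G 2 j \<union> B j)"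
  have Qc: "connected (Q j)" if "j < 3" for j
    unfolding Q_def
    by (intro path_connected_imp_connected path_connected_Un)
      (use A[of 2] B[OF that] pcG[of 2 j] that start[of 2 j] finish[of 2 j]
        pathstart_in_path_image[of "g 2 j"] pathfinish_in_path_image[of "g 2 j"] in auto)
  have Q1: "Q j \<inter> path_image (c k) = {}" if "j < 3" "k < 3" "j \<noteq> k" for j k
  proof -
    have "A 2 \<inter> (A 0 \<union> ?G 0 k) = {}" "A 2 \<inter> (A 1 \<union> ?G 1 k) = {}" "A 2 \<inter> B k = {}"
      using AA[of 0 2] AA[of 1 2] GA[of 0 k 2] GA[of 1 k 2] AB[of 2 k] that by auto
    moreover have "?G 2 j \<inter> (A 0 \<union> ?G 0 k) = {}" "?G 2 j \<inter> (A 1 \<union> ?G 1 k) = {}" "?G 2 j \<inter> B k = {}"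
      using GA[of 2 j 0] GA[of 2 j 1] GG1[of 2 j 0 k] GG1[of 2 j 1 k] GB[of 2 j k] that by auto
    moreover have "B j \<inter> (A 0 \<union> ?G 0 k) = {}" "B j \<inter> (A 1 \<union> ?G 1 k) = {}" "B j \<inter> B k = {}"
      using TB[of 0 k j] TB[of 1 k j] BB[of j k] that by auto
    ultimately have "Q j \<inter> ((A 0 \<union> ?G 0 k) \<union> B k \<union> (A 1 \<union> ?G 1 k)) = {}"
      unfolding Q_def by (simp add: Int_Un_distrib Int_Un_distrib2)
    moreover have "path_image (c k) \<subseteq> (A 0 \<union> ?G 0 k) \<union> B k \<union> (A 1 \<union> ?G 1 k)"
      using c[of k] T[of k] U[of k] that unfolding S_def by blast
    ultimately show ?thesis by blast
  qed
  \<comment> \<open>\<open>c j\<close> is only known to lie in \<open>S j\<close>. If it avoided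
    \<open>B j\<close>, the closed sets around \<open>a\<close> and around \<open>b\<close> would
    split it; this is where closedness of the \<open>A i\<close> enters.\<close>
  have Q2: "Q j \<inter> path_image (c j) \<noteq> {}" if "j < 3" for j
  proof
    assume "Q j \<inter> path_image (c j) = {}"
    then have n: "path_image (c j) \<inter> B j = {}" unfolding Q_def by blast
    let ?X = "A 0 \<union> ?G 0 j" and ?Y = "A 1 \<union> ?G 1 j"
    have "connected (path_image (c j))"
      using c[OF that] by (simp add: connected_path_image arc_imp_path)
    moreover have "closed ?X" "closed ?Y" using A clG that by auto
    moreover have "path_image (c j) \<subseteq> ?X \<union> ?Y"
      using n c[of j] T[of j] U[of j] that unfolding S_def by blast
    moreover have "?X \<inter> ?Y \<inter> path_image (c j) = {}" using TU[of j j] n that by auto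
    moreover have "?X \<inter> path_image (c j) \<noteq> {}" "?Y \<inter> path_image (c j) \<noteq> {}"
      using aA bA abc[OF that] by auto
    ultimately show False
      unfolding connected_closed by blast
  qed
  obtain q where "q \<in> A 2" using start[of 2 0] by auto
  then have q: "q \<in> Q j" for j by (auto simp: Q_def)
  show False
    by (rule theta_curve_obstruction[of "c 0" a b "c 1" "c 2" "Q 0" q "Q 1" "Q 2"])
      (use c cc Qc q Q1 Q2 in auto)
qed

text \<open>The branch sets of the minor are the label classes \<open>0, 1, 2\<close> on one side and \<open>3, 4, 5\<close> on the other;
  labels from \<open>6\<close> on mark unused vertices.\<close>

definition K33_minor :: "(nat \<Rightarrow> nat \<Rightarrow> bool) \<Rightarrow> bool" where
  "K33_minor A \<longleftrightarrow> (\<exists>f :: nat \<Rightarrow> nat.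
     (\<forall>u v. f u < 6 \<and> f u = f v \<longrightarrow> (\<lambda>a b. A a b \<and> f a = f b)\<^sup>*\<^sup>* u v) \<and>
     (\<forall>i<3. \<forall>j<3. \<exists>u v. f u = i \<and> f v = j + 3 \<and> A u v))"

section \<open>From a planar drawing to drawn branch sets\<close>

lemma planar_complex_drawing:
  assumes "planar V E"
  obtains P :: "nat \<Rightarrow> complex" and \<Gamma> where "inj_on P V"
    "\<forall>e\<in>E. arc (\<Gamma> e) \<and> {pathstart (\<Gamma> e), pathfinish (\<Gamma> e)} = P ` e \<and> path_image (\<Gamma> e) \<inter> P ` V \<subseteq> P ` e"
    "\<forall>e\<in>E. \<forall>e'\<in>E. e \<noteq> e' \<longrightarrow> path_image (\<Gamma> e) \<inter> path_image (\<Gamma> e') \<subseteq> P ` (e \<inter> e')"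
proof -
  obtain pos :: "nat \<Rightarrow> real^2" and \<gamma> where pos: "inj_on pos V"
    and g1: "\<forall>e\<in>E. arc (\<gamma> e) \<and> {pathstart (\<gamma> e), pathfinish (\<gamma> e)} = pos ` e \<and>
                 path_image (\<gamma> e) \<inter> pos ` V \<subseteq> pos ` e"
    and g2: "\<forall>e\<in>E. \<forall>e'\<in>E. e \<noteq> e' \<longrightarrow> path_image (\<gamma> e) \<inter> path_image (\<gamma> e') \<subseteq> pos ` (e \<inter> e')"
    using assms unfolding planar_def by (elim conjE exE)
  have g: "arc (\<gamma> e)" "{pathstart (\<gamma> e), pathfinish (\<gamma> e)} = pos ` e"
    "path_image (\<gamma> e) \<inter> pos ` V \<subseteq> pos ` e" if "e \<in> E" for e
    using g1 that by auto
  \<comment> \<open>The theta-curve argument is carried out in \<open>complex\<close>, drawings live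
    in \<open>real^2\<close>; an injective linear map preserves arcs and intersections.\<close>
  define h :: "real^2 \<Rightarrow> complex" where "h = (\<lambda>x. Complex (x $ 1) (x $ 2))"
  have lin: "linear h"
    by (rule linearI) (auto simp: h_def complex_eq_iff)
  have inj: "inj h"
    by (rule injI) (auto simp: h_def vec_eq_iff forall_2)
  have hi: "h ` X \<inter> h ` Y \<subseteq> h ` Z" if "X \<inter> Y \<subseteq> Z" for X Y Z
    using that inj by (auto simp: inj_def)
  show thesis
  proof (rule that[of "h \<circ> pos" "\<lambda>e. h \<circ> \<gamma> e"])
    show "inj_on (h \<circ> pos) V"
      using pos inj by (intro comp_inj_on) (auto intro: inj_on_subset)
    show "\<forall>e\<in>E. arc (h \<circ> \<gamma> e) \<and> {pathstart (h \<circ> \<gamma> e), pathfinish (h \<circ> \<gamma> e)} = (h \<circ> pos) ` e \<and>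
        path_image (h \<circ> \<gamma> e) \<inter> (h \<circ> pos) ` V \<subseteq> (h \<circ> pos) ` e"
    proof (intro ballI conjI)
      fix e assume e: "e \<in> E"
      show "arc (h \<circ> \<gamma> e)"
        using arc_linear_image_eq[OF lin inj] g(1)[OF e] by simp
      have "{pathstart (h \<circ> \<gamma> e), pathfinish (h \<circ> \<gamma> e)} = h ` {pathstart (\<gamma> e), pathfinish (\<gamma> e)}"
        by (auto simp: pathstart_def pathfinish_def)
      then show "{pathstart (h \<circ> \<gamma> e), pathfinish (h \<circ> \<gamma> e)} = (h \<circ> pos) ` e"
        unfolding g(2)[OF e] by (simp add: image_comp)
      show "path_image (h \<circ> \<gamma> e) \<inter> (h \<circ> pos) ` V \<subseteq> (h \<circ> pos) ` e"
        unfolding image_comp[symmetric] path_image_compose using hi g(3)[OF e] by blast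
    qed
    show "\<forall>e\<in>E. \<forall>e'\<in>E. e \<noteq> e' \<longrightarrow>
        path_image (h \<circ> \<gamma> e) \<inter> path_image (h \<circ> \<gamma> e') \<subseteq> (h \<circ> pos) ` (e \<inter> e')"
      unfolding image_comp[symmetric] path_image_compose
      by (intro ballI impI hi) (rule g2[rule_format])
  qed
qed

text \<open>A label class drawn together with the edges inside it is closed and path-connected, and
  different classes stay disjoint because drawn edges meet only in common ends. One drawn edge per
  pair of opposite classes is the link that \<open>no_planar_K33_of_continua\<close> asks
  for.\<close>

theorem planar_no_K33_minor:
  assumes pl: "planar V E"
  shows "\<not> K33_minor (\<lambda>u v. {u, v} \<in> E)"
proof
  assume "K33_minor (\<lambda>u v. {u, v} \<in> E)"
  then obtain f :: "nat \<Rightarrow> nat"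
    where conn: "\<And>u v. f u < 6 \<Longrightarrow> f u = f v \<Longrightarrow> (\<lambda>a b. {a, b} \<in> E \<and> f a = f b)\<^sup>*\<^sup>* u v"
      and cross: "\<forall>i<3. \<forall>j<3. \<exists>u v. f u = i \<and> f v = j + 3 \<and> {u, v} \<in> E"
    unfolding K33_minor_def by blast
  obtain u v where uv: "\<And>i j. i < 3 \<Longrightarrow> j < 3 \<Longrightarrow> f (u i j) = i \<and> f (v i j) = j + 3 \<and> {u i j, v i j} \<in> E"
    using cross by metis
  obtain P :: "nat \<Rightarrow> complex" and \<Gamma> where P: "inj_on P V"
    and G1: "\<forall>e\<in>E. arc (\<Gamma> e) \<and> {pathstart (\<Gamma> e), pathfinish (\<Gamma> e)} = P ` e \<and> path_image (\<Gamma> e) \<inter> P ` V \<subseteq> P ` e"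
    and G2: "\<forall>e\<in>E. \<forall>e'\<in>E. e \<noteq> e' \<longrightarrow> path_image (\<Gamma> e) \<inter> path_image (\<Gamma> e') \<subseteq> P ` (e \<inter> e')"
    by (rule planar_complex_drawing[OF pl])
  have arcG: "arc (\<Gamma> e)" and ends: "{pathstart (\<Gamma> e), pathfinish (\<Gamma> e)} = P ` e"
    and GV: "path_image (\<Gamma> e) \<inter> P ` V \<subseteq> P ` e" if "e \<in> E" for e
    using G1 that by auto
  note GG = G2[rule_format]
  have finV: "finite V" and sub: "\<And>e. e \<in> E \<Longrightarrow> e \<subseteq> V"
    using pl unfolding planar_def simple_graph_def by auto
  have finE: "finite E"
    by (rule finite_subset[of _ "Pow V"]) (use finV sub in auto)
  have PV: "P w \<in> P ` e \<longleftrightarrow> w \<in> e" if "w \<in> V" "e \<subseteq> V" for w e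
    using P that by (meson image_iff inj_on_contraD inj_on_image_mem_iff)
  have Pends: "P w \<in> path_image (\<Gamma> e)" if "e \<in> E" "w \<in> e" for w e
    using ends[OF that(1)] that(2) pathstart_in_path_image[of "\<Gamma> e"] pathfinish_in_path_image[of "\<Gamma> e"]
    by (metis image_eqI insertE singletonD)
  define C where "C = (\<lambda>i. P ` {w \<in> V. f w = i} \<union> (\<Union>e\<in>{e \<in> E. f ` e = {i}}. path_image (\<Gamma> e)))"
  have Gcomp: "path_component (C i) x y" if "e \<in> E" "f ` e = {i}" "x \<in> path_image (\<Gamma> e)" "y \<in> path_image (\<Gamma> e)"
    for e i x y
  proof -
    have "path_connected (path_image (\<Gamma> e))"
      using arcG[OF that(1)] by (simp add: arc_imp_path path_connected_path_image)
    then have "path_component (path_image (\<Gamma> e)) x y"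
      using that by (simp add: path_connected_component)
    moreover have "path_image (\<Gamma> e) \<subseteq> C i" using that by (auto simp: C_def)
    ultimately show ?thesis by (rule path_component_of_subset[rotated])
  qed
  have Vcomp: "path_component (C i) (P x) (P y)" if "x \<in> V" "y \<in> V" "f x = i" "f y = i" "i < 6" for i x y
  proof -
    have "(\<lambda>a b. {a, b} \<in> E \<and> f a = f b)\<^sup>*\<^sup>* x y" using conn that by auto
    then show ?thesis
    proof (induction rule: rtranclp_induct)
      case base
      show ?case using that by (intro path_component_refl) (auto simp: C_def)
    next
      case (step y z)
      have "f y = f x" using step(1) by (induction rule: rtranclp_induct) auto
      then have "f ` {y, z} = {i}" using step(2) that by auto
      then have "path_component (C i) (P y) (P z)"
        by (intro Gcomp[of "{y,z}"] Pends) (use step(2) in auto)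
      then show ?case using step.IH path_component_trans by blast
    qed
  qed
  have Cpc: "path_connected (C i)" if i: "i < 6" for i
  proof -
    have "\<exists>w. w \<in> V \<and> f w = i \<and> path_component (C i) x (P w)" if x: "x \<in> C i" for x
    proof (cases "x \<in> P ` {w \<in> V. f w = i}")
      case True
      then show ?thesis using that by (auto intro: path_component_refl)
    next
      case False
      then obtain e where e: "e \<in> E" "f ` e = {i}" "x \<in> path_image (\<Gamma> e)"
        using x by (auto simp: C_def)
      then obtain w where w: "w \<in> e" by blast
      then have "path_component (C i) x (P w)" using Gcomp[OF e] Pends[OF e(1) w] by blast
      then show ?thesis using e w sub by blast
    qed
    then show ?thesis
      unfolding path_connected_component
      using Vcomp[OF _ _ _ _ i] by (meson path_component_sym path_component_trans)
  qed
  have Ccl: "closed (C i)" for i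
    unfolding C_def using finV finE arcG
    by (intro closed_Un closed_UN) (auto intro: finite_imp_closed closed_arc_image)
  have CC: "C i \<inter> C k = {}" if ik: "i \<noteq> k" for i k
  proof -
    have PG: "P w \<notin> path_image (\<Gamma> e)" if "w \<in> V" "e \<in> E" "f ` e = {l}" "f w \<noteq> l" for w e l
      using GV[OF that(2)] PV[of w e] sub[OF that(2)] that by blast
    have GG0: "path_image (\<Gamma> e) \<inter> path_image (\<Gamma> e') = {}" if "e \<in> E" "e' \<in> E" "f ` e = {i}" "f ` e' = {k}" for e e'
    proof -
      have "f w = i" "f w = k" if "w \<in> e \<inter> e'" for w
        using that imageI[of w e f] imageI[of w e' f] \<open>f ` e = {i}\<close> \<open>f ` e' = {k}\<close> by simp_all
      then have "e \<inter> e' = {}" using ik by blast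
      moreover have "e \<noteq> e'" using that(3,4) ik by auto
      ultimately show ?thesis using GG[OF that(1,2)] by auto
    qed
    have PP: "P x \<noteq> P y" if "x \<in> V" "y \<in> V" "f x = i" "f y = k" for x y
      using P that ik by (metis inj_onD)
    have "x \<notin> C k" if xi: "x \<in> C i" for x
    proof
      assume "x \<in> C k"
      then consider y where "x = P y" "y \<in> V" "f y = k"
        | e where "e \<in> E" "f ` e = {k}" "x \<in> path_image (\<Gamma> e)" by (auto simp: C_def)
      note ck = this
      consider y where "x = P y" "y \<in> V" "f y = i"
        | e where "e \<in> E" "f ` e = {i}" "x \<in> path_image (\<Gamma> e)" using xi by (auto simp: C_def)
      then show False
      proof cases
        case (1 y)
        note y = this
        from ck show False
        proof cases
          case (1 z)
          then show False using PP[of y z] y by auto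
        next
          case (2 e)
          then show False using PG[of y e k] y ik by auto
        qed
      next
        case (2 e)
        note e = this
        from ck show False
        proof cases
          case (1 z)
          then show False using PG[of z e i] e ik by auto
        next
          case (2 e')
          then show False using GG0[of e e'] e by blast
        qed
      qed
    qed
    then show ?thesis by blast
  qed
  define e where "e = (\<lambda>i j. {u i j, v i j})"
  \<comment> \<open>A drawn edge has no prescribed direction; it is reversed where necessary so as
    to start in the class below 3.\<close>
  define g where "g = (\<lambda>i j. if pathstart (\<Gamma> (e i j)) = P (u i j) then \<Gamma> (e i j) else reversepath (\<Gamma> (e i j)))"
  have eE: "e i j \<in> E" if "i < 3" "j < 3" for i j
    using uv[OF that] by (simp add: e_def)
  have pig: "path_image (g i j) = path_image (\<Gamma> (e i j))" for i j
    by (simp add: g_def)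
  have gst: "arc (g i j)" "pathstart (g i j) = P (u i j)" "pathfinish (g i j) = P (v i j)" if "i < 3" "j < 3" for i j
  proof -
    have "{pathstart (\<Gamma> (e i j)), pathfinish (\<Gamma> (e i j))} = {P (u i j), P (v i j)}"
      using ends[OF eE[OF that]] by (simp add: e_def)
    then show "pathstart (g i j) = P (u i j)" "pathfinish (g i j) = P (v i j)"
      by (auto simp: g_def doubleton_eq_iff)
    show "arc (g i j)" using arcG[OF eE[OF that]] by (simp add: g_def arc_reversepath)
  qed
  have uvV: "u i j \<in> V" "v i j \<in> V" if "i < 3" "j < 3" for i j
    using sub[OF eE[OF that]] by (auto simp: e_def)
  have gC: "path_image (g i j) \<inter> C k \<subseteq> P ` {w \<in> e i j. f w = k}" if "i < 3" "j < 3" for i j k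
  proof
    fix x assume "x \<in> path_image (g i j) \<inter> C k"
    then have x: "x \<in> path_image (\<Gamma> (e i j))" "x \<in> C k" by (auto simp: pig)
    from x(2) consider y where "x = P y" "y \<in> V" "f y = k"
      | e' where "e' \<in> E" "f ` e' = {k}" "x \<in> path_image (\<Gamma> e')" by (auto simp: C_def)
    then show "x \<in> P ` {w \<in> e i j. f w = k}"
    proof cases
      case (1 y)
      then have "P y \<in> P ` e i j" using GV[OF eE[OF that]] x by blast
      then show ?thesis using PV[of y "e i j"] 1 sub[OF eE[OF that]] by blast
    next
      case (2 e')
      have "e' \<noteq> e i j" using 2(2) uv[OF that] that by (auto simp: e_def)
      then have "x \<in> P ` (e' \<inter> e i j)" using GG[OF 2(1) eE[OF that]] 2(3) x(1) by blast
      then show ?thesis using 2(2) by blast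
    qed
  qed
  show False
  proof (rule no_planar_K33_of_continua[of C "\<lambda>j. C (j + 3)" g])
    fix i j k l :: nat
    show "path_connected (C i) \<and> closed (C i)" "path_connected (C (i + 3))" if "i < 3"
      using Cpc Ccl that by auto
    show "C i \<inter> C k = {}" "C (i + 3) \<inter> C (k + 3) = {}" if "i < 3" "k < 3" "i \<noteq> k"
      using CC that by auto
    show "C i \<inter> C (k + 3) = {}" if "i < 3" "k < 3" using CC that by auto
    assume ij: "i < 3" "j < 3"
    show "arc (g i j) \<and> pathstart (g i j) \<in> C i \<and> pathfinish (g i j) \<in> C (j + 3)"
      using gst[OF ij] uv[OF ij] uvV[OF ij] by (auto simp: C_def)
    assume k: "k < 3"
    show "path_image (g i j) \<inter> C k \<subseteq> {pathstart (g i j)}" "path_image (g i j) \<inter> C (k + 3) \<subseteq> {pathfinish (g i j)}"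
      using gC[OF ij] gst[OF ij] uv[OF ij] k ij by (fastforce simp: e_def)+
    assume l: "l < 3" "(i, j) \<noteq> (k, l)"
    have "f ` e i j \<noteq> f ` e k l"
      using uv[OF ij] uv[OF k l(1)] l(2) ij k l(1) by (auto simp: e_def doubleton_eq_iff)
    then have "path_image (g i j) \<inter> path_image (g k l) \<subseteq> P ` (e i j \<inter> e k l)"
      unfolding pig using GG[OF eE[OF ij] eE[OF k l(1)]] by auto
    then show "path_image (g i j) \<inter> path_image (g k l) \<subseteq> {pathstart (g i j), pathfinish (g i j)}"
      using gst[OF ij] by (auto simp: e_def)
  qed
qed

section \<open>Graphs without \<open>K\<^sub>3\<^sub>,\<^sub>3\<close> minor\<close>

lemma K33_minor_mono:
  assumes "K33_minor A" and "\<And>u v. A u v \<Longrightarrow> B u v"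
  shows "K33_minor B"
proof -
  obtain f :: "nat \<Rightarrow> nat" where f1: "\<forall>u v. f u < 6 \<and> f u = f v \<longrightarrow> (\<lambda>a b. A a b \<and> f a = f b)\<^sup>*\<^sup>* u v"
    and f2: "\<forall>i<3. \<forall>j<3. \<exists>u v. f u = i \<and> f v = j + 3 \<and> A u v"
    using assms(1) unfolding K33_minor_def by (elim exE conjE)
  have "(\<lambda>a b. B a b \<and> f a = f b)\<^sup>*\<^sup>* u v" if "f u < 6" "f u = f v" for u v
  proof -
    have "(\<lambda>a b. A a b \<and> f a = f b)\<^sup>*\<^sup>* u v" using f1 that by blast
    then show ?thesis
      by (induction rule: rtranclp_induct) (auto intro: rtranclp.rtrancl_into_rtrancl assms(2))
  qed
  moreover have "\<forall>i<3. \<forall>j<3. \<exists>u v. f u = i \<and> f v = j + 3 \<and> B u v"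
    using f2 assms(2) by meson
  ultimately show ?thesis unfolding K33_minor_def by blast
qed

text \<open>The working form for producing minors: three stars, each contracted to its centre,
  against three single vertices of \<open>T\<close>. An empty leaf set stands for a plain
  vertex.\<close>

lemma K33_minor_stars:
  assumes sym: "\<And>u v. A u v \<Longrightarrow> A v u"
    and T: "3 \<le> card T"
    and X: "\<And>w. w \<in> X \<Longrightarrow> A x w" and Y: "\<And>w. w \<in> Y \<Longrightarrow> A y w" and Z: "\<And>w. w \<in> Z \<Longrightarrow> A z w"
    and disj: "insert x X \<inter> insert y Y = {}" "insert x X \<inter> insert z Z = {}" "insert y Y \<inter> insert z Z = {}"
      "T \<inter> (insert x X \<union> insert y Y \<union> insert z Z) = {}"
    and XT: "\<And>t. t \<in> T \<Longrightarrow> \<exists>w\<in>insert x X. A w t"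
    and YT: "\<And>t. t \<in> T \<Longrightarrow> \<exists>w\<in>insert y Y. A w t"
    and ZT: "\<And>t. t \<in> T \<Longrightarrow> \<exists>w\<in>insert z Z. A w t"
  shows "K33_minor A"
proof -
  obtain T' where T': "T' \<subseteq> T" "card T' = 3"
    using obtain_subset_with_card_n[OF T] by metis
  then obtain t0 t1 t2 where t: "T' = {t0, t1, t2}" "t0 \<noteq> t1" "t0 \<noteq> t2" "t1 \<noteq> t2"
    by (auto simp: card_3_iff)
  define f :: "nat \<Rightarrow> nat" where "f = (\<lambda>w. if w \<in> insert x X then 0 else if w \<in> insert y Y then 1
    else if w \<in> insert z Z then 2 else if w = t0 then 3 else if w = t1 then 4 else if w = t2 then 5 else 6)"
  have fX: "f w = 0" if "w \<in> insert x X" for w using that by (simp add: f_def)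
  have fY: "f w = 1" if "w \<in> insert y Y" for w using that disj by (auto simp: f_def)
  have fZ: "f w = 2" if "w \<in> insert z Z" for w using that disj by (auto simp: f_def)
  have tT: "t0 \<in> T" "t1 \<in> T" "t2 \<in> T" using T' t by auto
  have nT: "w \<notin> insert x X" "w \<notin> insert y Y" "w \<notin> insert z Z" if "w \<in> T" for w
    using disj(4) that by blast+
  have ft: "f t0 = 3" "f t1 = 4" "f t2 = 5"
    unfolding f_def using nT[OF tT(1)] nT[OF tT(2)] nT[OF tT(3)] t(2-4) by simp_all
  have inv: "f w = 0 \<Longrightarrow> w \<in> insert x X" "f w = 1 \<Longrightarrow> w \<in> insert y Y" "f w = 2 \<Longrightarrow> w \<in> insert z Z"
    "f w = 3 \<Longrightarrow> w = t0" "f w = 4 \<Longrightarrow> w = t1" "f w = 5 \<Longrightarrow> w = t2" for w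
    unfolding f_def by (simp_all only: split: if_splits)
  have star: "(\<lambda>a b. A a b \<and> f a = f b)\<^sup>*\<^sup>* u v"
    if "\<And>w. w \<in> S \<Longrightarrow> A c w" "\<And>w. w \<in> insert c S \<Longrightarrow> f w = i" "u \<in> insert c S" "v \<in> insert c S" for u v c S i
  proof -
    have "(\<lambda>a b. A a b \<and> f a = f b)\<^sup>*\<^sup>* u c"
      using that sym by (cases "u = c") (auto intro!: r_into_rtranclp)
    moreover have "(\<lambda>a b. A a b \<and> f a = f b)\<^sup>*\<^sup>* c v"
      using that by (cases "v = c") (auto intro!: r_into_rtranclp)
    ultimately show ?thesis by (rule rtranclp_trans)
  qed
  have "(\<lambda>a b. A a b \<and> f a = f b)\<^sup>*\<^sup>* u v" if uv: "f u < 6" "f u = f v" for u v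
  proof -
    consider "f u = 0" | "f u = 1" | "f u = 2" | "f u = 3" | "f u = 4" | "f u = 5" using uv(1) by linarith
    then show ?thesis
    proof cases
      case 1
      then have "u \<in> insert x X" "v \<in> insert x X" using uv inv(1)[of u] inv(1)[of v] by simp_all
      then show ?thesis by (intro star[of X x 0] X fX)
    next
      case 2
      then have "u \<in> insert y Y" "v \<in> insert y Y" using uv inv(2)[of u] inv(2)[of v] by simp_all
      then show ?thesis by (intro star[of Y y 1] Y fY)
    next
      case 3
      then have "u \<in> insert z Z" "v \<in> insert z Z" using uv inv(3)[of u] inv(3)[of v] by simp_all
      then show ?thesis by (intro star[of Z z 2] Z fZ)
    next
      case 4
      then have "u = t0" "v = t0" using uv inv(4)[of u] inv(4)[of v] by simp_all
      then show ?thesis by simp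
    next
      case 5
      then have "u = t1" "v = t1" using uv inv(5)[of u] inv(5)[of v] by simp_all
      then show ?thesis by simp
    next
      case 6
      then have "u = t2" "v = t2" using uv inv(6)[of u] inv(6)[of v] by simp_all
      then show ?thesis by simp
    qed
  qed
  moreover have "\<exists>u v. f u = i \<and> f v = j + 3 \<and> A u v" if ij: "i < 3" "j < 3" for i j
  proof -
    have "j = 0 \<or> j = 1 \<or> j = 2" using ij by linarith
    then obtain t where t': "t \<in> T" "f t = j + 3"
      using tT ft by fastforce
    have "i = 0 \<or> i = 1 \<or> i = 2" using ij by linarith
    moreover obtain a b c where "a \<in> insert x X" "A a t" "b \<in> insert y Y" "A b t" "c \<in> insert z Z" "A c t"
      using XT[OF t'(1)] YT[OF t'(1)] ZT[OF t'(1)] by metis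
    ultimately show ?thesis
      using fX[of a] fY[of b] fZ[of c] t'(2) by metis
  qed
  ultimately show ?thesis unfolding K33_minor_def by blast
qed

text \<open>To undo the contraction, \<open>y\<close> receives the label of \<open>x\<close>. An
  edge that the quotient attributes to \<open>x\<close> may really be one at \<open>y\<close>; the
  edge between \<open>x\<close> and \<open>y\<close> supplies the detour inside the class.\<close>

lemma K33_minor_contract:
  assumes sym: "\<And>u v. A u v \<Longrightarrow> A v u" and xy: "A x y" "x \<noteq> y"
    and minor: "K33_minor (\<lambda>u v. u \<noteq> y \<and> v \<noteq> y \<and> u \<noteq> v \<and> (A u v \<or> u = x \<and> A y v \<or> v = x \<and> A u y))"
  shows "K33_minor A"
proof -
  define B where "B = (\<lambda>u v. u \<noteq> y \<and> v \<noteq> y \<and> u \<noteq> v \<and> (A u v \<or> u = x \<and> A y v \<or> v = x \<and> A u y))"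
  obtain f :: "nat \<Rightarrow> nat" where f1: "\<forall>u v. f u < 6 \<and> f u = f v \<longrightarrow> (\<lambda>a b. B a b \<and> f a = f b)\<^sup>*\<^sup>* u v"
    and f2: "\<forall>i<3. \<forall>j<3. \<exists>u v. f u = i \<and> f v = j + 3 \<and> B u v"
    using minor unfolding K33_minor_def B_def[symmetric] by (elim exE conjE)
  define g where "g = f(y := f x)"
  let ?r = "\<lambda>a b. A a b \<and> g a = g b"
  have yx: "?r\<^sup>*\<^sup>* y x" "?r\<^sup>*\<^sup>* x y"
    using xy sym by (auto simp: g_def intro!: r_into_rtranclp)
  have step: "?r\<^sup>*\<^sup>* a b" if ab: "B a b" "f a = f b" for a b
  proof -
    have ne: "a \<noteq> y" "b \<noteq> y" using ab by (auto simp: B_def)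
    consider "A a b" | "a = x" "A y b" | "b = x" "A a y" using ab by (auto simp: B_def)
    then show ?thesis
    proof cases
      case 1
      then show ?thesis using ne that by (auto simp: g_def intro!: r_into_rtranclp)
    next
      case 2
      then have "?r y b" using ne that by (auto simp: g_def)
      then have "?r\<^sup>*\<^sup>* y b" by (rule r_into_rtranclp)
      then show ?thesis using rtranclp_trans[OF yx(2)] 2(1) by blast
    next
      case 3
      then have "?r a y" using ne that by (auto simp: g_def)
      then have "?r\<^sup>*\<^sup>* a y" by (rule r_into_rtranclp)
      then show ?thesis using rtranclp_trans[OF _ yx(1)] 3(1) by blast
    qed
  qed
  have path: "?r\<^sup>*\<^sup>* u v" if "u \<noteq> y" "v \<noteq> y" "g u < 6" "g u = g v" for u v
  proof -
    have "f u < 6" "f u = f v" using that by (auto simp: g_def)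
    then have "(\<lambda>a b. B a b \<and> f a = f b)\<^sup>*\<^sup>* u v" using f1 by blast
    then show ?thesis
      by (induction rule: rtranclp_induct) (use step in \<open>auto intro: rtranclp_trans\<close>)
  qed
  have gy: "g y = g x" using xy by (simp add: g_def)
  have "?r\<^sup>*\<^sup>* u v" if "g u < 6" "g u = g v" for u v
  proof -
    consider "u = y" "v = y" | "u = y" "v \<noteq> y" | "u \<noteq> y" "v = y" | "u \<noteq> y" "v \<noteq> y" by blast
    then show ?thesis
    proof cases
      case 2
      then have "?r\<^sup>*\<^sup>* x v" using that gy xy by (intro path) auto
      then show ?thesis using yx(1) 2 by (auto intro: rtranclp_trans)
    next
      case 3
      then have "?r\<^sup>*\<^sup>* u x" using that gy xy by (intro path) auto
      then show ?thesis using yx(2) 3 by (auto intro: rtranclp_trans)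
    qed (use path that in auto)
  qed
  moreover have "\<exists>u v. g u = i \<and> g v = j + 3 \<and> A u v" if ij: "i < 3" "j < 3" for i j
  proof -
    obtain u v where uv: "f u = i" "f v = j + 3" "B u v" using f2 ij by blast
    then have ne: "u \<noteq> y" "v \<noteq> y" by (auto simp: B_def)
    consider "A u v" | "u = x" "A y v" | "v = x" "A u y" using uv(3) by (auto simp: B_def)
    then show ?thesis
    proof cases
      case 1
      then show ?thesis using uv ne by (auto simp: g_def)
    next
      case 2
      then have "g y = i" "g v = j + 3" using uv ne by (auto simp: g_def)
      then show ?thesis using 2 by blast
    next
      case 3
      then have "g u = i" "g y = j + 3" using uv ne by (auto simp: g_def)
      then show ?thesis using 3 by blast
    qed
  qed
  ultimately show ?thesis unfolding K33_minor_def by blast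
qed

text \<open>The branch set that absorbs the centre of a Y whose three leaves have labels \<open>x\<close>, \<open>y\<close>, \<open>z\<close>. It works
  because three branch sets of \<open>K\<^sub>3\<^sub>,\<^sub>3\<close> are never pairwise adjacent.\<close>

lemma K33_cluster_label:
  fixes x y z :: nat
  defines "opp \<equiv> \<lambda>p q::nat. p < 3 \<and> 3 \<le> q \<and> q < 6 \<or> q < 3 \<and> 3 \<le> p \<and> p < 6"
  shows "\<exists>b. (x = y \<and> x < 6 \<longrightarrow> b = x) \<and> (x = z \<and> x < 6 \<longrightarrow> b = x) \<and> (y = z \<and> y < 6 \<longrightarrow> b = y) \<and>
    (opp x y \<longrightarrow> b = x \<or> b = y) \<and> (opp x z \<longrightarrow> b = x \<or> b = z) \<and> (opp y z \<longrightarrow> b = y \<or> b = z) \<and>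
    (b < 6 \<longrightarrow> b = x \<or> b = y \<or> b = z)"
proof -
  consider "x < 6" "x = y \<or> x = z" | "y < 6" "y = z" | "x < 6 \<longrightarrow> x \<noteq> y \<and> x \<noteq> z" "y < 6 \<longrightarrow> y \<noteq> z" by blast
  then show ?thesis
  proof cases
    case 1
    then show ?thesis by (intro exI[of _ x]) (auto simp: opp_def)
  next
    case 2
    then show ?thesis by (intro exI[of _ y]) (auto simp: opp_def)
  next
    case 3
    note distinct = this
    \<comment> \<open>\<open>opp\<close> is bipartite, so at most two of the three pairs are
      opposite, and two such pairs share a label, which is taken as \<open>b\<close>.\<close>
    consider "opp x y" "opp x z" | "opp x y" "\<not> opp x z" | "\<not> opp x y" "opp x z" | "\<not> opp x y" "\<not> opp x z" by blast
    then show ?thesis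
    proof cases
      case 1
      then have "\<not> opp y z" by (auto simp: opp_def)
      then show ?thesis using 1 distinct by (intro exI[of _ x]) auto
    next
      case 2
      then show ?thesis using distinct by (intro exI[of _ y]) auto
    next
      case 3
      then show ?thesis using distinct by (intro exI[of _ z]) auto
    next
      case 4
      then show ?thesis using distinct by (intro exI[of _ "if opp y z then y else 6"]) auto
    qed
  qed
qed

text \<open>Each centre \<open>s\<close> joins the branch set that \<open>K33_cluster_label\<close>
  picks for its leaves. Every cluster edge used by the minor is then realised through its own
  centre, so overlapping clusters do not interfere.\<close>

lemma K33_minor_Y_Delta:
  assumes sym: "\<And>u v. A u v \<Longrightarrow> A v u"
    and tau: "\<And>s. s \<in> S \<Longrightarrow> finite (\<tau> s) \<and> card (\<tau> s) \<le> 3 \<and> \<tau> s \<subseteq> R \<and> (\<forall>v\<in>\<tau> s. A s v)"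
    and SR: "S \<inter> R = {}"
    and minor: "K33_minor (\<lambda>u v. u \<in> R \<and> v \<in> R \<and> u \<noteq> v \<and> (A u v \<or> (\<exists>s\<in>S. u \<in> \<tau> s \<and> v \<in> \<tau> s)))"
  shows "K33_minor A"
proof -
  define B where "B = (\<lambda>u v. u \<in> R \<and> v \<in> R \<and> u \<noteq> v \<and> (A u v \<or> (\<exists>s\<in>S. u \<in> \<tau> s \<and> v \<in> \<tau> s)))"
  obtain f :: "nat \<Rightarrow> nat" where f1: "\<forall>u v. f u < 6 \<and> f u = f v \<longrightarrow> (\<lambda>a b. B a b \<and> f a = f b)\<^sup>*\<^sup>* u v"
    and f2: "\<forall>i<3. \<forall>j<3. \<exists>u v. f u = i \<and> f v = j + 3 \<and> B u v"
    using minor unfolding K33_minor_def B_def[symmetric] by (elim exE conjE)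
  \<comment> \<open>Three duties of a centre labelled \<open>b\<close>: connect leaves of equal
    label, realise the adjacencies between opposite sides, and hang on a leaf of its own label so
    that its class stays connected.\<close>
  define good where "good = (\<lambda>D b. (\<forall>u\<in>D. \<forall>v\<in>D. u \<noteq> v \<and> f u = f v \<and> f u < 6 \<longrightarrow> b = f u) \<and>
      (\<forall>u\<in>D. \<forall>v\<in>D. f u < 3 \<and> 3 \<le> f v \<and> f v < 6 \<longrightarrow> b = f u \<or> b = f v) \<and>
      (b < 6 \<longrightarrow> (\<exists>u\<in>D. f u = b)))"
  have "\<exists>b. good (\<tau> s) b" if s: "s \<in> S" for s
  proof -
    have "card (\<tau> s) = 0 \<or> card (\<tau> s) = 1 \<or> card (\<tau> s) = 2 \<or> card (\<tau> s) = 3" using tau[OF s] by linarith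
    then consider "\<tau> s = {}" | a where "\<tau> s = {a}" | a b where "\<tau> s = {a, b}" "a \<noteq> b"
      | a b c where "\<tau> s = {a, b, c}" "a \<noteq> b" "a \<noteq> c" "b \<noteq> c"
      using tau[OF s] by (auto simp: card_1_singleton_iff card_2_iff card_3_iff)
    then show ?thesis
    proof cases
      case 1
      then show ?thesis by (auto simp: good_def intro!: exI[of _ 6])
    next
      case (2 a)
      then show ?thesis by (auto simp: good_def)
    next
      case (3 a b)
      have "\<exists>l. (f a = f b \<and> f a < 6 \<longrightarrow> l = f a) \<and>
          (f a < 3 \<and> 3 \<le> f b \<and> f b < 6 \<or> f b < 3 \<and> 3 \<le> f a \<and> f a < 6 \<longrightarrow> l = f a \<or> l = f b) \<and>
          (l < 6 \<longrightarrow> l = f a \<or> l = f b)"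
        by (rule exI[of _ "if f a < 6 then f a else 6"]) auto
      then obtain l where l: "(f a = f b \<and> f a < 6 \<longrightarrow> l = f a)"
        "f a < 3 \<and> 3 \<le> f b \<and> f b < 6 \<or> f b < 3 \<and> 3 \<le> f a \<and> f a < 6 \<longrightarrow> l = f a \<or> l = f b"
        "l < 6 \<longrightarrow> l = f a \<or> l = f b"
        by (elim exE conjE)
      then have "good (\<tau> s) l" using 3 by (auto simp: good_def)
      then show ?thesis ..
    next
      case (4 a b c)
      obtain l where l: "(f a = f b \<and> f a < 6 \<longrightarrow> l = f a)" "(f a = f c \<and> f a < 6 \<longrightarrow> l = f a)"
        "(f b = f c \<and> f b < 6 \<longrightarrow> l = f b)"
        "f a < 3 \<and> 3 \<le> f b \<and> f b < 6 \<or> f b < 3 \<and> 3 \<le> f a \<and> f a < 6 \<longrightarrow> l = f a \<or> l = f b"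
        "f a < 3 \<and> 3 \<le> f c \<and> f c < 6 \<or> f c < 3 \<and> 3 \<le> f a \<and> f a < 6 \<longrightarrow> l = f a \<or> l = f c"
        "f b < 3 \<and> 3 \<le> f c \<and> f c < 6 \<or> f c < 3 \<and> 3 \<le> f b \<and> f b < 6 \<longrightarrow> l = f b \<or> l = f c"
        "l < 6 \<longrightarrow> l = f a \<or> l = f b \<or> l = f c"
        using K33_cluster_label[of "f a" "f b" "f c"] by (elim exE conjE)
      have lt3: "\<not> (f w < 3 \<and> 3 \<le> f w)" for w by simp
      have "\<forall>u\<in>\<tau> s. \<forall>v\<in>\<tau> s. u \<noteq> v \<and> f u = f v \<and> f u < 6 \<longrightarrow> l = f u"
        unfolding 4(1) using l(1-3) by (intro ballI impI) (elim insertE emptyE, simp_all)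
      moreover have "\<forall>u\<in>\<tau> s. \<forall>v\<in>\<tau> s. f u < 3 \<and> 3 \<le> f v \<and> f v < 6 \<longrightarrow> l = f u \<or> l = f v"
        unfolding 4(1) using l(4-6) lt3 by (intro ballI impI) (elim insertE emptyE; hypsubst; blast)
      moreover have "l < 6 \<longrightarrow> (\<exists>u\<in>\<tau> s. f u = l)"
        unfolding 4(1) using l(7) by auto
      ultimately have "good (\<tau> s) l" unfolding good_def by blast
      then show ?thesis ..
    qed
  qed
  then obtain \<beta> where \<beta>: "\<And>s. s \<in> S \<Longrightarrow> good (\<tau> s) (\<beta> s)" by metis
  have b1: "\<beta> s = f u" if "s \<in> S" "u \<in> \<tau> s" "v \<in> \<tau> s" "u \<noteq> v" "f u = f v" "f u < 6" for s u v
    using \<beta>[OF that(1)] that unfolding good_def by blast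
  have b2: "\<beta> s = f u \<or> \<beta> s = f v" if "s \<in> S" "u \<in> \<tau> s" "v \<in> \<tau> s" "f u < 3" "3 \<le> f v" "f v < 6" for s u v
    using \<beta>[OF that(1)] that unfolding good_def by blast
  have b3: "\<exists>u\<in>\<tau> s. f u = \<beta> s" if "s \<in> S" "\<beta> s < 6" for s
    using \<beta>[OF that(1)] that unfolding good_def by blast
  define g where "g = (\<lambda>w. if w \<in> R then f w else if w \<in> S then \<beta> w else 6)"
  have gR: "g w = f w" if "w \<in> R" for w using that by (simp add: g_def)
  have gS: "g w = \<beta> w" if "w \<in> S" for w using that SR by (auto simp: g_def)
  let ?r = "\<lambda>a b. A a b \<and> g a = g b"
  have step: "?r\<^sup>*\<^sup>* a b" if ab: "B a b" "f a = f b" "f a < 6" for a b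
  proof -
    have R: "a \<in> R" "b \<in> R" "a \<noteq> b" using ab by (auto simp: B_def)
    consider "A a b" | s where "s \<in> S" "a \<in> \<tau> s" "b \<in> \<tau> s" using ab by (auto simp: B_def)
    then show ?thesis
    proof cases
      case 1
      then show ?thesis using R ab gR by (auto intro!: r_into_rtranclp)
    next
      case (2 s)
      have "\<beta> s = f a" using b1[OF 2 R(3)] ab by auto
      then have "?r a s" "?r s b" using 2 R gR gS tau[OF 2(1)] ab sym by auto
      then show ?thesis using rtranclp_trans[OF r_into_rtranclp[of ?r a s] r_into_rtranclp[of ?r s b]] by blast
    qed
  qed
  have pathR: "?r\<^sup>*\<^sup>* u v" if "u \<in> R" "v \<in> R" "g u < 6" "g u = g v" for u v
  proof -
    have "f u < 6" "f u = f v" using that gR by auto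
    then have "(\<lambda>a b. B a b \<and> f a = f b)\<^sup>*\<^sup>* u v" using f1 by blast
    then have "?r\<^sup>*\<^sup>* u v \<and> f v = f u"
      by (induction rule: rtranclp_induct)
        (use step \<open>f u < 6\<close> in \<open>auto intro: rtranclp_trans\<close>)
    then show ?thesis by blast
  qed
  have toR: "\<exists>w\<in>R. g w = g u \<and> ?r\<^sup>*\<^sup>* u w \<and> ?r\<^sup>*\<^sup>* w u" if u: "g u < 6" for u
  proof (cases "u \<in> R")
    case True
    then show ?thesis by blast
  next
    case False
    then have uS: "u \<in> S" using u by (auto simp: g_def split: if_splits)
    then obtain w where w: "w \<in> \<tau> u" "f w = \<beta> u" using b3[OF uS] u gS by auto
    then have wR: "w \<in> R" "A u w" "A w u" using tau[OF uS] sym by auto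
    then have "?r u w" "?r w u" using w gR gS uS by auto
    then show ?thesis using wR(1) by (intro bexI[of _ w]) (auto intro: r_into_rtranclp)
  qed
  have "?r\<^sup>*\<^sup>* u v" if uv: "g u < 6" "g u = g v" for u v
  proof -
    obtain u' where u': "u' \<in> R" "g u' = g u" "?r\<^sup>*\<^sup>* u u'" using toR[of u] uv by auto
    obtain v' where v': "v' \<in> R" "g v' = g v" "?r\<^sup>*\<^sup>* v' v" using toR[of v] uv by auto
    have "?r\<^sup>*\<^sup>* u' v'" using pathR[OF u'(1) v'(1)] u' v' uv by simp
    then show ?thesis using u'(3) v'(3) by (meson rtranclp_trans)
  qed
  moreover have "\<exists>u v. g u = i \<and> g v = j + 3 \<and> A u v" if ij: "i < 3" "j < 3" for i j
  proof -
    obtain u v where uv: "f u = i" "f v = j + 3" "B u v" using f2 ij by blast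
    then have R: "u \<in> R" "v \<in> R" by (auto simp: B_def)
    have gu: "g u = i" "g v = j + 3" using gR R uv by auto
    consider "A u v" | s where "s \<in> S" "u \<in> \<tau> s" "v \<in> \<tau> s" using uv by (auto simp: B_def)
    then show ?thesis
    proof cases
      case 1
      then show ?thesis using gu by (intro exI[of _ u] exI[of _ v]) simp
    next
      case (2 s)
      then have "\<beta> s = i \<or> \<beta> s = j + 3" using b2[OF 2] uv ij by auto
      moreover have "A s v" "A u s" using tau[OF 2(1)] 2 sym by auto
      ultimately consider "g s = i" "A s v" | "g s = j + 3" "A u s" using gS[OF 2(1)] by auto
      then show ?thesis
        by cases (use gu in \<open>auto intro: exI[of _ s]\<close>)
    qed
  qed
  ultimately show ?thesis unfolding K33_minor_def by blast
qed

section \<open>Edge density without the minor\<close>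

lemma sum_split_two:
  fixes f :: "'a \<Rightarrow> nat"
  assumes "finite W" "x \<in> W" "y \<in> W" "x \<noteq> y"
  shows "sum f W = f x + f y + sum f (W - {x, y})"
proof -
  have "sum f W = f x + sum f (W - {x})" using assms by (simp add: sum.remove)
  also have "sum f (W - {x}) = f y + sum f (W - {x} - {y})"
    using assms by (intro sum.remove) auto
  also have "W - {x} - {y} = W - {x, y}" by auto
  finally show ?thesis by simp
qed

text \<open>Identifying the ends of an edge destroys this edge and merges one pair of parallel edges
  per common neighbour; each lost edge counts twice in the degree sum.\<close>

lemma degree_sum_contract:
  assumes fin: "finite W" and sym: "\<And>u v. A u v \<Longrightarrow> A v u" and irr: "\<And>u. \<not> A u u"
    and xy: "x \<in> W" "y \<in> W" "A x y"
  shows "(\<Sum>u\<in>W. card {v \<in> W. A u v}) =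
    (\<Sum>u\<in>W - {y}. card {v \<in> W - {y}. u \<noteq> y \<and> v \<noteq> y \<and> u \<noteq> v \<and> (A u v \<or> u = x \<and> A y v \<or> v = x \<and> A u y)})
    + 2 + 2 * card ({v \<in> W. A x v} \<inter> {v \<in> W. A y v})"
proof -
  define N where "N = (\<lambda>u. {v \<in> W. A u v})"
  define N' where "N' = (\<lambda>u. {v \<in> W - {y}. u \<noteq> y \<and> v \<noteq> y \<and> u \<noteq> v \<and> (A u v \<or> u = x \<and> A y v \<or> v = x \<and> A u y)})"
  define D where "D = N x \<inter> N y"
  have finN: "finite (N u)" for u using fin by (simp add: N_def)
  have ne: "x \<noteq> y" using xy irr by auto
  have yx: "A y x" using sym xy by blast
  have card_other: "card (N u) = card (N' u) + (if u \<in> D then 1 else 0)" if u: "u \<in> W - {x, y}" for u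
  proof -
    have ux: "u \<noteq> x" "u \<noteq> y" using u by auto
    consider "\<not> A u y" | "A u y" "A u x" | "A u y" "\<not> A u x" by blast
    then show ?thesis
    proof cases
      case 1
      then have "N' u = N u" using ux irr by (auto simp: N_def N'_def)
      moreover have "u \<notin> D" using 1 sym by (auto simp: D_def N_def)
      ultimately show ?thesis by simp
    next
      case 2
      then have "N u = insert y (N' u)" "y \<notin> N' u" using ux irr xy by (auto simp: N_def N'_def)
      moreover have "finite (N' u)" using fin by (simp add: N'_def)
      moreover have "u \<in> D" using 2 sym u by (auto simp: D_def N_def)
      ultimately show ?thesis by simp
    next
      case 3
      have 1: "N' u = insert x (N u - {y})" using 3 ux irr xy ne by (auto simp: N_def N'_def)
      have 2: "x \<notin> N u" "y \<in> N u" using 3 xy by (auto simp: N_def)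
      have "card (insert x (N u - {y})) = Suc (card (N u - {y}))" using 2 finN by simp
      then have "card (N' u) = card (N u)" using 1 card.remove[OF finN 2(2)] by simp
      moreover have "u \<notin> D" using 3 sym by (auto simp: D_def N_def)
      ultimately show ?thesis by simp
    qed
  qed
  have Nx: "N x \<union> N y = insert x (insert y (N' x))" "x \<notin> insert y (N' x)" "y \<notin> N' x"
    using xy yx ne irr by (auto simp: N_def N'_def)
  have "card (N x) + card (N y) = card (N x \<union> N y) + card D"
    unfolding D_def by (rule card_Un_Int[OF finN finN])
  also have "card (N x \<union> N y) = card (N' x) + 2"
    unfolding Nx(1) using Nx(2,3) fin by (simp add: N'_def)
  finally have 1: "card (N x) + card (N y) = card (N' x) + 2 + card D" .
  have "(\<Sum>u\<in>W - {x, y}. card (N u)) = (\<Sum>u\<in>W - {x, y}. card (N' u)) + (\<Sum>u\<in>W - {x, y}. if u \<in> D then 1 else 0)"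
    unfolding sum.distrib[symmetric] by (rule sum.cong) (use card_other in auto)
  also have "(\<Sum>u\<in>W - {x, y}. if u \<in> D then 1 else 0) = card ((W - {x, y}) \<inter> D)"
    using fin by (simp add: sum.inter_restrict[symmetric])
  also have "(W - {x, y}) \<inter> D = D" using irr by (auto simp: D_def N_def)
  finally have 2: "(\<Sum>u\<in>W - {x, y}. card (N u)) = (\<Sum>u\<in>W - {x, y}. card (N' u)) + card D" .
  have 3: "(\<Sum>u\<in>W. card (N u)) = card (N x) + card (N y) + (\<Sum>u\<in>W - {x, y}. card (N u))"
    using sum_split_two[OF fin xy(1,2) ne] by simp
  have "(\<Sum>u\<in>W - {y}. card (N' u)) = card (N' x) + (\<Sum>u\<in>W - {y} - {x}. card (N' u))"
    using fin xy ne by (intro sum.remove) auto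
  also have "W - {y} - {x} = W - {x, y}" by auto
  finally have 4: "(\<Sum>u\<in>W - {y}. card (N' u)) = card (N' x) + (\<Sum>u\<in>W - {x, y}. card (N' u))" .
  have "(\<Sum>u\<in>W. card (N u)) = (\<Sum>u\<in>W - {y}. card (N' u)) + 2 + 2 * card D"
    using 1 2 3 4 by linarith
  then show ?thesis unfolding N_def N'_def D_def .
qed

lemma degree_sum_delete_edge:
  assumes fin: "finite W" and sym: "\<And>u v. A u v \<Longrightarrow> A v u" and irr: "\<And>u. \<not> A u u"
    and xy: "x \<in> W" "y \<in> W" "A x y"
  shows "(\<Sum>u\<in>W. card {v \<in> W. A u v}) = (\<Sum>u\<in>W. card {v \<in> W. A u v \<and> {u, v} \<noteq> {x, y}}) + 2"
proof -
  have ne: "x \<noteq> y" using xy irr by auto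
  let ?N = "\<lambda>u. {v \<in> W. A u v}" and ?M = "\<lambda>u. {v \<in> W. A u v \<and> {u, v} \<noteq> {x, y}}"
  have "?N x = insert y (?M x)" "y \<notin> ?M x" using xy ne by (auto simp: doubleton_eq_iff)
  then have 1: "card (?N x) = card (?M x) + 1" using fin by simp
  have "?N y = insert x (?M y)" "x \<notin> ?M y" using xy sym ne by (auto simp: doubleton_eq_iff)
  then have 2: "card (?N y) = card (?M y) + 1" using fin by simp
  have "?N u = ?M u" if "u \<in> W - {x, y}" for u using that by (auto simp: doubleton_eq_iff)
  then have "(\<Sum>u\<in>W - {x, y}. card (?N u)) = (\<Sum>u\<in>W - {x, y}. card (?M u))"
    by (intro sum.cong) auto
  then show ?thesis
    using 1 2 sum_split_two[OF fin xy(1,2) ne, of "\<lambda>u. card (?N u)"]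
      sum_split_two[OF fin xy(1,2) ne, of "\<lambda>u. card (?M u)"] by simp
qed

text \<open>In a minimal counterexample every edge lies in four triangles and some vertex \<open>x\<close> has at most seven
  neighbours; two of these then have three common neighbours inside the neighbourhood of \<open>x\<close>.\<close>

theorem K33_free_degree_sum:
  assumes "finite W" "W \<noteq> {}" and "\<And>u v. A u v \<Longrightarrow> A v u" and "\<And>u. \<not> A u u" and "\<not> K33_minor A"
  shows "(\<Sum>u\<in>W. card {v \<in> W. A u v}) + 4 \<le> 8 * card W"
  using assms
proof (induction "card W + (\<Sum>u\<in>W. card {v \<in> W. A u v})" arbitrary: W A rule: less_induct)
  case less
  note fin = less.prems(1) and sym = less.prems(3) and irr = less.prems(4) and K = less.prems(5)
  let ?s = "\<Sum>u\<in>W. card {v \<in> W. A u v}"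
  define N where "N = (\<lambda>u. {v \<in> W. A u v})"
  have finN: "finite (N u)" for u using fin by (simp add: N_def)
  show ?case
  proof (rule ccontr)
    assume neg: "\<not> ?s + 4 \<le> 8 * card W"
    have pos: "0 < card W" using less.prems by (simp add: card_gt_0_iff)
    have n1: "card W \<noteq> 1"
    proof
      assume c1: "card W = 1"
      then obtain w where W: "W = {w}" by (auto simp: card_1_singleton_iff)
      have "{v \<in> W. A w v} = {}" using irr W by auto
      then have "?s = 0" unfolding W by simp
      then show False using neg c1 by linarith
    qed
    \<comment> \<open>Deleting an edge and using minimality caps the sum below
      \<open>8 * card W\<close>; this cap yields the vertex of degree at most 7.\<close>
    have del: "?s \<le> 8 * card W - 2" if "x \<in> W" "y \<in> W" "A x y" for x y
    proof -
      let ?B = "\<lambda>u v. A u v \<and> {u, v} \<noteq> {x, y}"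
      have eq: "?s = (\<Sum>u\<in>W. card {v \<in> W. ?B u v}) + 2"
        by (rule degree_sum_delete_edge[OF fin sym irr that])
      have "\<not> K33_minor ?B" using K K33_minor_mono[of ?B A] by blast
      then have "(\<Sum>u\<in>W. card {v \<in> W. ?B u v}) + 4 \<le> 8 * card W"
        by (intro less.hyps) (use eq less.prems sym in \<open>auto simp: insert_commute\<close>)
      then show ?thesis using eq by linarith
    qed
    \<comment> \<open>The negated claim gives a sum of at least \<open>8 * card W - 3\<close>, the
      contracted graph has at most \<open>8 * card W - 12\<close>. The loss \<open>2 + 2 c\<close>
      for \<open>c\<close> common neighbours is thus at least 9.\<close>
    have tri: "4 \<le> card (N x \<inter> N y)" if "x \<in> W" "y \<in> W" "A x y" for x y
    proof -
      let ?B = "\<lambda>u v. u \<noteq> y \<and> v \<noteq> y \<and> u \<noteq> v \<and> (A u v \<or> u = x \<and> A y v \<or> v = x \<and> A u y)"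
      have ne: "x \<noteq> y" using that irr by auto
      have eq: "?s = (\<Sum>u\<in>W - {y}. card {v \<in> W - {y}. ?B u v}) + 2 + 2 * card (N x \<inter> N y)"
        unfolding N_def by (rule degree_sum_contract[OF fin sym irr that])
      have cW: "card (W - {y}) = card W - 1" using that fin by simp
      have "\<not> K33_minor ?B" using K K33_minor_contract[of A x y] sym that(3) ne by blast
      then have "(\<Sum>u\<in>W - {y}. card {v \<in> W - {y}. ?B u v}) + 4 \<le> 8 * card (W - {y})"
        using eq cW fin that ne sym by (intro less.hyps) auto
      then show ?thesis using eq cW neg by linarith
    qed
    obtain x where x: "x \<in> W" "card (N x) \<le> 7"
    proof (rule ccontr)
      assume "\<not> thesis"
      then have "8 \<le> card (N u)" if "u \<in> W" for u using that \<open>\<And>x. \<lbrakk>x \<in> W; card (N x) \<le> 7\<rbrakk> \<Longrightarrow> thesis\<close>[of u] by linarith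
      then have "8 * card W \<le> ?s"
        using sum_bounded_below[of W 8 "\<lambda>u. card (N u)"] by (simp add: N_def mult.commute)
      moreover have "\<exists>u\<in>W. \<exists>v\<in>W. A u v"
      proof (rule ccontr)
        assume "\<not> ?thesis"
        then have "{v \<in> W. A u v} = {}" if "u \<in> W" for u using that by blast
        then have "card {v \<in> W. A u v} = 0" if "u \<in> W" for u using that by (metis card.empty)
        then have "?s = 0" by (intro sum.neutral) blast
        then show False using neg pos by linarith
      qed
      ultimately show False using del pos by force
    qed
    \<comment> \<open>Removing an isolated vertex would keep the sum and lower the bound by
      8.\<close>
    have "N x \<noteq> {}"
    proof
      assume e: "N x = {}"
      let ?W = "W - {x}"
      have cW: "card ?W = card W - 1" using x fin by simp
      have "{v \<in> W. A u v} = {v \<in> ?W. A u v}" if "u \<in> W" for u using that e sym by (auto simp: N_def)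
      then have "(\<Sum>u\<in>?W. card {v \<in> ?W. A u v}) = (\<Sum>u\<in>?W. card {v \<in> W. A u v})"
        by (intro sum.cong) (metis DiffD1)+
      also have "\<dots> = card (N x) + (\<Sum>u\<in>?W. card {v \<in> W. A u v})" using e by simp
      also have "\<dots> = ?s" unfolding N_def by (rule sum.remove[OF fin x(1), symmetric])
      finally have eq: "(\<Sum>u\<in>?W. card {v \<in> ?W. A u v}) = ?s" .
      have "?W \<noteq> {}" using n1 pos cW by (metis One_nat_def Suc_pred card.empty)
      then have "(\<Sum>u\<in>?W. card {v \<in> ?W. A u v}) + 4 \<le> 8 * card ?W"
        using eq cW pos less.prems by (intro less.hyps) auto
      then show False using eq neg cW by linarith
    qed
    then obtain a where a: "a \<in> N x" by blast
    have t4: "4 \<le> card (N x \<inter> N b)" if "b \<in> N x" for b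
      using tri[of x b] x that by (auto simp: N_def)
    have "\<exists>a b. a \<in> N x \<and> b \<in> N x \<and> a \<noteq> b \<and> 3 \<le> card (N x \<inter> N a \<inter> N b)"
    proof (cases "\<exists>b\<in>N x. b \<noteq> a \<and> \<not> A a b")
      case True
      then obtain b where b: "b \<in> N x" "b \<noteq> a" "\<not> A a b" by blast
      let ?X = "N x \<inter> N a" and ?Y = "N x \<inter> N b"
      \<comment> \<open>Two sets of size at least 4 inside a set of size at most 5 share three
        elements.\<close>
      have "?X \<union> ?Y \<subseteq> N x - {a, b}" using b sym irr by (auto simp: N_def)
      then have "card (?X \<union> ?Y) \<le> card (N x - {a, b})" by (intro card_mono) (use finN in auto)
      also have "\<dots> = card (N x) - 2" using a b finN by (simp add: card_Diff_subset)
      finally have "card (?X \<union> ?Y) \<le> 5" using x by linarith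
      moreover have "card ?X + card ?Y = card (?X \<union> ?Y) + card (?X \<inter> ?Y)"
        by (rule card_Un_Int) (use finN in auto)
      moreover have "card (?X \<inter> ?Y) = card (N x \<inter> N a \<inter> N b)" by (rule arg_cong[of _ _ card]) auto
      ultimately have "3 \<le> card (N x \<inter> N a \<inter> N b)" using t4[OF a] t4[OF b(1)] by linarith
      then show ?thesis using a b by blast
    next
      case False
      have "N x \<inter> N a \<noteq> {}" using t4[OF a] by force
      then obtain b where b: "b \<in> N x" "b \<in> N a" by blast
      have ab: "a \<noteq> b" using b irr by (auto simp: N_def)
      \<comment> \<open>Here \<open>a\<close> is adjacent to everything else in \<open>N x\<close>,
        so only \<open>a\<close> itself is lost when passing to common neighbours with
        \<open>a\<close>.\<close>
      have "N x \<inter> N b \<subseteq> insert a (N x \<inter> N a \<inter> N b)" using False by (auto simp: N_def)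
      then have "card (N x \<inter> N b) \<le> card (insert a (N x \<inter> N a \<inter> N b))" by (intro card_mono) (use finN in auto)
      also have "\<dots> \<le> Suc (card (N x \<inter> N a \<inter> N b))" by (simp add: card_insert_if finN)
      finally have "3 \<le> card (N x \<inter> N a \<inter> N b)" using t4[OF b(1)] by linarith
      then show ?thesis using a b ab by blast
    qed
    then obtain a b where ab: "a \<in> N x" "b \<in> N x" "a \<noteq> b" "3 \<le> card (N x \<inter> N a \<inter> N b)" by blast
    have "K33_minor A"
      by (rule K33_minor_stars[where X = "{}" and x = x and Y = "{}" and y = a and Z = "{}" and z = b,
            OF sym ab(4)]) (use ab irr in \<open>auto simp: N_def\<close>)
    then show False using K by blast
  qed
qed

section \<open>Neighbours of the same adjacency type\<close>

text \<open>The branch sets against \<open>T\<close> are the two hubs and the star around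
  \<open>u\<close>, whose leaves are the middle vertices of the 2-paths from
  \<open>u\<close>.\<close>

lemma K33_minor_hubs_star:
  assumes sym: "\<And>u v. A u v \<Longrightarrow> A v u" and irr: "\<And>u. \<not> A u u"
    and ne: "y \<noteq> z" "u \<noteq> y" "u \<noteq> z" "u \<notin> T" and T: "3 \<le> card T"
    and hubs: "\<And>t. t \<in> T \<Longrightarrow> A y t \<and> A z t"
    and reach: "\<And>t. t \<in> T \<Longrightarrow> A u t \<or> (\<exists>w. w \<noteq> y \<and> w \<noteq> z \<and> w \<notin> T \<and> A u w \<and> A w t)"
  shows "K33_minor A"
proof -
  define H where "H = {w. w \<noteq> y \<and> w \<noteq> z \<and> w \<notin> T \<and> A u w}"
  have yT: "y \<notin> T" "z \<notin> T" using hubs irr by auto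
  have "\<exists>w\<in>insert u H. A w t" if "t \<in> T" for t
    using reach[OF that] by (auto simp: H_def)
  then show ?thesis
    by (intro K33_minor_stars[where X = "{}" and x = y and Y = "{}" and y = z and Z = H and z = u, OF sym T])
      (use ne yT hubs in \<open>auto simp: H_def\<close>)
qed

text \<open>Link two vertices of \<open>C\<close> if they are adjacent or joined through a vertex
  outside \<open>C\<close> and the hubs. Three links at one vertex would give a minor with the hubs,
  and \<open>joined\<close> bounds distances in the link graph by two: at most
  \<open>1 + 2 + 2\<close> vertices.\<close>

lemma card_two_hub_class_le:
  assumes sym: "\<And>u v. A u v \<Longrightarrow> A v u" and irr: "\<And>u. \<not> A u u" and K: "\<not> K33_minor A"
    and fin: "finite C" and yz: "y \<noteq> z"
    and hubs: "\<And>c. c \<in> C \<Longrightarrow> A y c \<and> A z c"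
    and joined: "\<And>u v. u \<in> C \<Longrightarrow> v \<in> C \<Longrightarrow> u \<noteq> v \<Longrightarrow> A u v \<or> (\<exists>w. w \<noteq> y \<and> w \<noteq> z \<and> A w u \<and> A w v)"
  shows "card C \<le> 5"
proof (cases "C = {}")
  case False
  then obtain c where c: "c \<in> C" by blast
  define D where "D = (\<lambda>c. {v \<in> C - {c}. A c v \<or> (\<exists>w. w \<noteq> y \<and> w \<noteq> z \<and> w \<notin> C \<and> A c w \<and> A w v)})"
  have finD: "finite (D u)" for u using fin by (simp add: D_def)
  have D2: "card (D u) \<le> 2" if u: "u \<in> C" for u
  proof (rule ccontr)
    assume "\<not> card (D u) \<le> 2"
    then have T: "3 \<le> card (D u)" by simp
    have "u \<noteq> y" "u \<noteq> z" using hubs[OF u] irr by auto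
    moreover have "u \<notin> D u" by (simp add: D_def)
    moreover have "A y t \<and> A z t" if "t \<in> D u" for t using that hubs by (simp add: D_def)
    moreover have "A u t \<or> (\<exists>w. w \<noteq> y \<and> w \<noteq> z \<and> w \<notin> D u \<and> A u w \<and> A w t)" if "t \<in> D u" for t
      using that by (auto simp: D_def)
    ultimately have "K33_minor A"
      by (intro K33_minor_hubs_star[where A = A and u = u, OF sym irr yz _ _ _ T]) blast+
    then show False using K by blast
  qed
  have Dsym: "u \<in> D v" if "v \<in> D u" "u \<in> C" for u v
    using that sym by (auto simp: D_def)
  have "C \<subseteq> insert c (D c \<union> (\<Union>w\<in>D c. D w - {c}))"
  proof
    fix v assume v: "v \<in> C"
    show "v \<in> insert c (D c \<union> (\<Union>w\<in>D c. D w - {c}))"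
    proof (cases "v = c \<or> v \<in> D c")
      case False
      then have vc: "v \<noteq> c" "v \<notin> D c" by auto
      then obtain w where w: "w \<noteq> y" "w \<noteq> z" "A w c" "A w v"
        using joined[OF c v] v by (auto simp: D_def)
      then have wC: "w \<in> C" using vc v sym by (auto simp: D_def)
      have "w \<noteq> c" "w \<noteq> v" using w irr by auto
      then have "w \<in> D c" "v \<in> D w" using w wC v sym by (auto simp: D_def)
      then show ?thesis using vc by blast
    qed auto
  qed
  then have "card C \<le> card (insert c (D c \<union> (\<Union>w\<in>D c. D w - {c})))"
    by (intro card_mono) (use finD in auto)
  also have "\<dots> \<le> Suc (card (D c \<union> (\<Union>w\<in>D c. D w - {c})))"
    by (simp add: card_insert_if finD)
  also have "\<dots> \<le> Suc (card (D c) + card (\<Union>w\<in>D c. D w - {c}))"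
    using card_Un_le by blast
  also have "card (\<Union>w\<in>D c. D w - {c}) \<le> (\<Sum>w\<in>D c. card (D w - {c}))"
    by (rule card_UN_le[OF finD])
  \<comment> \<open>One of the two links at \<open>w\<close> leads back to \<open>c\<close>.\<close>
  also have "(\<Sum>w\<in>D c. card (D w - {c})) \<le> (\<Sum>w\<in>D c. 1)"
  proof (rule sum_mono)
    fix w assume w: "w \<in> D c"
    then have "w \<in> C" "c \<in> D w" using Dsym[OF w c] by (auto simp: D_def)
    then show "card (D w - {c}) \<le> 1" using D2[of w] finD by simp
  qed
  finally show ?thesis using D2[OF c] by simp
qed simp

text \<open>The hub \<open>y\<close> and stars around two vertices of \<open>Q\<close> form one side
  of the minor. A vertex other than \<open>y\<close> sees at most two vertices of \<open>Q\<close>,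
  so no leaf that reaches a vertex of \<open>T\<close> can belong to both stars.\<close>

lemma card_same_type_le_8:
  assumes sym: "\<And>u v. A u v \<Longrightarrow> A v u" and irr: "\<And>u. \<not> A u u" and K: "\<not> K33_minor A"
    and fin: "finite Q" and hub: "\<And>u. u \<in> Q \<Longrightarrow> A y u"
    and joined: "\<And>u v. u \<in> Q \<Longrightarrow> v \<in> Q \<Longrightarrow> u \<noteq> v \<Longrightarrow> A u v \<or> (\<exists>w. w \<noteq> y \<and> A w u \<and> A w v)"
    and few: "\<And>z. z \<noteq> y \<Longrightarrow> card {v \<in> Q. A z v} \<le> 2"
  shows "card Q \<le> 8"
proof (rule ccontr)
  assume "\<not> card Q \<le> 8"
  then have Q9: "9 \<le> card Q" by simp
  then obtain Q2 where "Q2 \<subseteq> Q" "card Q2 = 2" using obtain_subset_with_card_n[of 2 Q] by auto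
  then obtain x1 x2 where x: "x1 \<in> Q" "x2 \<in> Q" "x1 \<noteq> x2" by (auto simp: card_2_iff)
  define B where "B = (\<lambda>z. {v \<in> Q. A z v})"
  have finB: "finite (B z)" for z using fin by (simp add: B_def)
  have B2: "card (B z) \<le> 2" if "z \<noteq> y" for z using few[OF that] by (simp add: B_def)
  have yQ: "y \<notin> Q" using hub irr by auto
  \<comment> \<open>The vertices reached from \<open>x\<close> through another vertex of
    \<open>Q\<close>, which might itself lie in \<open>T\<close>. There are at most two such
    \<open>w\<close>, each seeing at most one vertex besides \<open>x\<close>.\<close>
  define bad where "bad = (\<lambda>x. \<Union>w\<in>B x. B w - {x})"
  have bad2: "card (bad x) \<le> 2" if x: "x \<in> Q" for x
  proof -
    have "card (bad x) \<le> (\<Sum>w\<in>B x. card (B w - {x}))"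
      unfolding bad_def by (rule card_UN_le[OF finB])
    also have "\<dots> \<le> (\<Sum>w\<in>B x. 1)"
    proof (rule sum_mono)
      fix w assume w: "w \<in> B x"
      then have "x \<in> B w" "w \<noteq> y" using x sym yQ by (auto simp: B_def)
      then show "card (B w - {x}) \<le> 1" using B2[of w] finB by simp
    qed
    also have "\<dots> \<le> 2" using B2[of x] x yQ by auto
    finally show ?thesis .
  qed
  have direct: "A x v \<or> (\<exists>w. w \<noteq> y \<and> w \<notin> Q \<and> A x w \<and> A w v)" if "x \<in> Q" "v \<in> Q" "v \<noteq> x" "v \<notin> bad x" for x v
    using joined[OF that(1,2)] that sym by (auto simp: bad_def B_def)
  \<comment> \<open>At most six vertices are removed, so three of nine remain.\<close>
  define T where "T = Q - ({x1, x2} \<union> bad x1 \<union> bad x2)"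
  have finbad: "finite (bad x)" for x using finB by (simp add: bad_def)
  have "card ({x1, x2} \<union> bad x1 \<union> bad x2) \<le> card {x1, x2} + card (bad x1) + card (bad x2)"
    by (meson add_le_mono1 card_Un_le order_trans)
  also have "\<dots> \<le> 6" using x bad2[OF x(1)] bad2[OF x(2)] by simp
  finally have "card ({x1, x2} \<union> bad x1 \<union> bad x2) \<le> 6" .
  then have T3: "3 \<le> card T"
    unfolding T_def using diff_card_le_card_Diff[of "{x1, x2} \<union> bad x1 \<union> bad x2" Q] finbad Q9 by simp
  have TQ: "T \<subseteq> Q" "x1 \<notin> T" "x2 \<notin> T" by (auto simp: T_def)
  define H where "H = (\<lambda>x. {w. w \<noteq> y \<and> w \<notin> Q \<and> A x w \<and> (\<exists>t\<in>T. A w t)})"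
  have reach: "\<exists>w\<in>insert x (H x). A w t" if "t \<in> T" "x = x1 \<or> x = x2" for t x
    using direct[of x t] that x by (auto simp: T_def H_def)
  have "H x1 \<inter> H x2 = {}"
  proof (rule ccontr)
    assume "H x1 \<inter> H x2 \<noteq> {}"
    then obtain w t where w: "w \<noteq> y" "A x1 w" "A x2 w" "t \<in> T" "A w t" by (auto simp: H_def)
    then have "{x1, x2, t} \<subseteq> B w" using sym x TQ by (auto simp: B_def)
    then have "card {x1, x2, t} \<le> card (B w)" by (intro card_mono finB)
    moreover have "card {x1, x2, t} = 3" using x w TQ by (auto simp: card_3_iff)
    ultimately show False using B2[OF w(1)] by simp
  qed
  then have "K33_minor A"
    by (intro K33_minor_stars[where X = "{}" and x = y and Y = "H x1" and y = x1 and Z = "H x2" and z = x2, OF sym T3])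
      (use x yQ TQ hub reach in \<open>auto simp: H_def\<close>)
  then show False using K by blast
qed

text \<open>Take \<open>z\<close> with the largest number of neighbours \<open>B\<close> in \<open>Q\<close>. A vertex of \<open>Q\<close> outside \<open>B \<union> {z}\<close> reaches at most
  two vertices of \<open>B\<close> without passing through \<open>B\<close>, which forces \<open>card B \<le> 4\<close>.\<close>

lemma card_same_type_bound:
  assumes sym: "\<And>u v. A u v \<Longrightarrow> A v u" and irr: "\<And>u. \<not> A u u" and K: "\<not> K33_minor A"
    and fin: "finite Q" and hub: "\<And>u. u \<in> Q \<Longrightarrow> A y u"
    and joined: "\<And>u v. u \<in> Q \<Longrightarrow> v \<in> Q \<Longrightarrow> u \<noteq> v \<Longrightarrow> A u v \<or> (\<exists>w. w \<noteq> y \<and> A w u \<and> A w v)"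
  shows "card Q \<le> 17 \<or> (\<exists>z. z \<noteq> y \<and> Q \<subseteq> insert z {v. A z v})"
proof -
  define N where "N = (\<lambda>z. {v \<in> Q. A z v})"
  have finN: "finite (N z)" for z using fin by (simp add: N_def)
  have yQ: "y \<notin> Q" using hub irr by auto
  have "\<exists>z. z \<noteq> y \<and> (\<forall>z'. z' \<noteq> y \<longrightarrow> card (N z') \<le> card (N z))"
    by (rule ex_has_greatest_nat[of _ "Suc y" _ "Suc (card Q)"]) (use fin in \<open>auto simp: N_def less_Suc_eq_le intro!: card_mono\<close>)
  then obtain z where z: "z \<noteq> y" and zmax: "\<And>z'. z' \<noteq> y \<Longrightarrow> card (N z') \<le> card (N z)" by blast
  define B where "B = N z"
  define U where "U = Q - insert z B"
  have BQ: "B \<subseteq> Q" and finB: "finite B" and Bz: "\<And>b. b \<in> B \<Longrightarrow> A y b \<and> A z b"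
    using finN hub by (auto simp: B_def N_def)
  have neB: "b \<noteq> y" "b \<noteq> z" if "b \<in> B" for b using Bz[OF that] irr by auto
  show ?thesis
  proof (cases "U = {}")
    case True
    then have "Q \<subseteq> insert z {v. A z v}" by (auto simp: U_def B_def N_def)
    then show ?thesis using z by blast
  next
    case False
    \<comment> \<open>The part of \<open>B\<close> that a star around \<open>u\<close> reaches with
      leaves outside \<open>B\<close>; three such vertices would complete the hubs \<open>y\<close>
      and \<open>z\<close> to a minor.\<close>
    define T where "T = (\<lambda>u. {b \<in> B. A u b \<or> (\<exists>w. w \<noteq> y \<and> w \<noteq> z \<and> w \<notin> B \<and> A u w \<and> A w b)})"
    have finT: "finite (T u)" and TB: "T u \<subseteq> B" for u using finB by (auto simp: T_def)
    have U: "u \<in> Q" "u \<noteq> z" "u \<notin> B" "u \<noteq> y" "\<not> A z u" if "u \<in> U" for u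
      using that yQ by (auto simp: U_def B_def N_def)
    have T2: "card (T u) \<le> 2" if u: "u \<in> U" for u
    proof (rule ccontr)
      assume "\<not> card (T u) \<le> 2"
      then have T3: "3 \<le> card (T u)" by simp
      have "u \<notin> T u" using U[OF u] TB by blast
      moreover have "A y t \<and> A z t" if "t \<in> T u" for t using that Bz TB by blast
      moreover have "A u t \<or> (\<exists>w. w \<noteq> y \<and> w \<noteq> z \<and> w \<notin> T u \<and> A u w \<and> A w t)" if "t \<in> T u" for t
        using that by (auto simp: T_def)
      ultimately have "K33_minor A"
        by (intro K33_minor_hubs_star[where A = A, OF sym irr z[symmetric] U(4)[OF u] U(2)[OF u] _ T3]) blast+
      then show False using K by blast
    qed
    \<comment> \<open>Any other \<open>b\<close> is joined to \<open>u\<close> through some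
      \<open>w\<close> in \<open>B\<close>, and this \<open>w\<close> is in \<open>T u\<close> as a
      neighbour of \<open>u\<close>.\<close>
    have via: "\<exists>w\<in>T u. A u w \<and> A w b" if u: "u \<in> U" and b: "b \<in> B" "b \<notin> T u" for u b
    proof -
      have "b \<noteq> u" using U[OF u] b by auto
      moreover have "\<not> A u b" using b by (auto simp: T_def)
      ultimately obtain w where w: "w \<noteq> y" "A w u" "A w b"
        using joined[of u b] U[OF u] b BQ by auto
      have "w \<noteq> z" using w U[OF u] by auto
      then have "w \<in> B" using w b sym by (auto simp: T_def)
      then show ?thesis using w sym by (auto simp: T_def)
    qed
    have B4: "card B \<le> 4"
    proof -
      obtain u where u: "u \<in> U" using False by blast
      define X where "X = (\<lambda>w. {b \<in> B - T u. A w b})"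
      have finX: "finite (X w)" for w using finB by (simp add: X_def)
      define W where "W = {w \<in> T u. A u w}"
      have WT: "W \<subseteq> T u" by (auto simp: W_def)
      have finW: "finite W" by (rule finite_subset[OF WT finT])
      have "B \<subseteq> T u \<union> (\<Union>w\<in>W. X w)" using via[OF u] by (fastforce simp: X_def W_def)
      then have "card B \<le> card (T u \<union> (\<Union>w\<in>W. X w))"
        by (intro card_mono) (use finT finX finW in auto)
      also have "\<dots> \<le> card (T u) + card (\<Union>w\<in>W. X w)" by (rule card_Un_le)
      also have "card (\<Union>w\<in>W. X w) \<le> (\<Sum>w\<in>W. card (X w))"
        by (rule card_UN_le[OF finW])
      finally have cB: "card B \<le> card (T u) + (\<Sum>w\<in>W. card (X w))" by simp
      have X2: "card (X w) \<le> 2" if w: "w \<in> W" for w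
      proof (rule ccontr)
        assume "\<not> card (X w) \<le> 2"
        then have X3: "3 \<le> card (X w)" by simp
        have wB: "w \<in> B" "w \<in> T u" using w WT TB by auto
        have "K33_minor A"
          by (rule K33_minor_hubs_star[where A = A, OF sym irr z[symmetric] neB(1)[OF wB(1)] neB(2)[OF wB(1)] _ X3])
            (use wB Bz in \<open>auto simp: X_def\<close>)
        then show False using K by blast
      qed
      \<comment> \<open>With \<open>w\<close> as an additional leaf, the star around
        \<open>u\<close> reaches all of \<open>X w\<close> and still \<open>w'\<close>.\<close>
      have X1: "card (X w) \<le> 1" if w: "w \<in> W" and w': "w' \<in> T u" "w' \<noteq> w" for w w'
      proof (rule ccontr)
        assume "\<not> card (X w) \<le> 1"
        moreover have w'X: "w' \<notin> X w" using w' by (auto simp: X_def)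
        ultimately have T3: "3 \<le> card (insert w' (X w))" using finX by simp
        have wB: "w \<in> B" "w \<in> T u" "A u w" "w' \<in> B" using w w' TB by (auto simp: W_def)
        have wn: "w \<notin> insert w' (X w)" using w' wB by (auto simp: X_def)
        have XB: "insert w' (X w) \<subseteq> B" using wB by (auto simp: X_def)
        have "A u t \<or> (\<exists>v. v \<noteq> y \<and> v \<noteq> z \<and> v \<notin> insert w' (X w) \<and> A u v \<and> A v t)"
          if t: "t \<in> insert w' (X w)" for t
        proof (cases "t = w'")
          case True
          then have "A u t \<or> (\<exists>v. v \<noteq> y \<and> v \<noteq> z \<and> v \<notin> B \<and> A u v \<and> A v t)" using w' by (auto simp: T_def)
          then show ?thesis using XB by blast
        next
          case False
          then have "A w t" using t by (auto simp: X_def)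
          then show ?thesis using wn wB neB[OF wB(1)] by blast
        qed
        moreover have "A y t \<and> A z t" if "t \<in> insert w' (X w)" for t using that XB Bz by blast
        moreover have "u \<notin> insert w' (X w)" using XB U[OF u] by blast
        ultimately have "K33_minor A"
          by (intro K33_minor_hubs_star[where A = A, OF sym irr z[symmetric] U(4)[OF u] U(2)[OF u] _ T3]) blast+
        then show False using K by blast
      qed
      \<comment> \<open>Either \<open>T u\<close> has two elements and each \<open>X w\<close> at
        most one, or \<open>T u\<close> has at most one element and each \<open>X w\<close> at most
        two; the totals are at most 4 and 3.\<close>
      show ?thesis
      proof (cases "\<exists>w w'. w \<in> T u \<and> w' \<in> T u \<and> w' \<noteq> w")
        case True
        have "(\<Sum>w\<in>W. card (X w)) \<le> (\<Sum>w\<in>W. 1)"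
          by (rule sum_mono) (use True X1 in metis)
        also have "\<dots> \<le> card (T u)" using card_mono[OF finT WT] by simp
        finally show ?thesis using cB T2[OF u] by linarith
      next
        case False
        then have "card (T u) \<le> 1" using card_le_Suc0_iff_eq[OF finT, of u] by auto
        moreover have "(\<Sum>w\<in>W. card (X w)) \<le> (\<Sum>w\<in>W. 2)"
          by (rule sum_mono) (use X2 in blast)
        moreover have "card W \<le> card (T u)" using card_mono[OF finT WT] .
        ultimately show ?thesis using cB by simp
      qed
    qed
    show ?thesis
    proof (cases "card B \<le> 2")
      case True
      have "card Q \<le> 8"
      proof (rule card_same_type_le_8[OF sym irr K fin hub joined])
        fix z' assume "z' \<noteq> y"
        then show "card {v \<in> Q. A z' v} \<le> 2" using zmax[of z'] True by (simp add: N_def B_def)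
      qed
      then show ?thesis by simp
    next
      case False
      define W where "W = {w \<in> B. \<exists>b\<in>B. A w b}"
      \<comment> \<open>As \<open>B\<close> has at least three elements, some \<open>b\<close> is
        outside \<open>T u\<close>, so \<open>u\<close> is adjacent to a vertex of \<open>B\<close>
        that has a neighbour in \<open>B\<close>.\<close>
      have UW: "U \<subseteq> (\<Union>w\<in>W. N w - B)"
      proof
        fix u assume u: "u \<in> U"
        have "\<not> B \<subseteq> T u" using T2[OF u] False card_mono[OF finT, of B u] by linarith
        then obtain b where b: "b \<in> B" "b \<notin> T u" by blast
        then obtain w where w: "w \<in> T u" "A u w" "A w b" using via[OF u b] by blast
        then have "w \<in> W" using TB b by (auto simp: W_def)
        moreover have "u \<in> N w - B" using w sym U[OF u] by (auto simp: N_def)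
        ultimately show "u \<in> (\<Union>w\<in>W. N w - B)" by blast
      qed
      \<comment> \<open>By maximality \<open>w\<close> has at most \<open>card B <= 4\<close>
        neighbours in \<open>Q\<close>, and at least one of them is in \<open>B\<close>.\<close>
      have N3: "card (N w - B) \<le> 3" if w: "w \<in> W" for w
      proof -
        obtain b where b: "b \<in> B" "A w b" using w by (auto simp: W_def)
        have "N w - B \<subseteq> N w - {b}" using b by auto
        then have "card (N w - B) \<le> card (N w - {b})" by (intro card_mono) (use finN in auto)
        also have "\<dots> = card (N w) - 1" using b BQ finN by (auto simp: N_def)
        also have "card (N w) \<le> card B" using zmax[of w] w neB by (auto simp: W_def B_def)
        finally show ?thesis using B4 by linarith
      qed
      have "card U \<le> card (\<Union>w\<in>W. N w - B)"
        by (rule card_mono[OF _ UW]) (use finN finB in \<open>auto simp: W_def\<close>)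
      also have "\<dots> \<le> (\<Sum>w\<in>W. card (N w - B))" by (rule card_UN_le) (use finB in \<open>auto simp: W_def\<close>)
      also have "\<dots> \<le> (\<Sum>w\<in>W. 3)" by (rule sum_mono) (use N3 in blast)
      also have "\<dots> \<le> 3 * card B" using card_mono[OF finB, of W] by (auto simp: W_def)
      finally have cU: "card U \<le> 12" using B4 by linarith
      \<comment> \<open>Counting \<open>z\<close>, \<open>B\<close> and \<open>U\<close>:
        \<open>1 + 4 + 12 = 17\<close>.\<close>
      have "Q \<subseteq> insert z (B \<union> U)" by (auto simp: U_def)
      then have "card Q \<le> card (insert z (B \<union> U))" by (intro card_mono) (use finB fin in \<open>auto simp: U_def\<close>)
      also have "\<dots> \<le> Suc (card (B \<union> U))" by (simp add: card_insert_if finB fin U_def)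
      also have "\<dots> \<le> Suc (card B + card U)" using card_Un_le by blast
      finally show ?thesis using cU B4 by linarith
    qed
  qed
qed

section \<open>The upper bound\<close>

lemma colored_mixed_graphD:
  assumes "colored_mixed_graph m n G"
  shows "finite (verts G)"
    and "lab G u v \<noteq> None \<Longrightarrow> u \<in> verts G \<and> v \<in> verts G \<and> u \<noteq> v"
    and "lab G v u = map_option flip_adj (lab G u v)"
    and "lab G u v = Some (Fwd i) \<Longrightarrow> i < m"
    and "lab G u v = Some (Edg j) \<Longrightarrow> j < n"
  using assms unfolding colored_mixed_graph_def by blast+

text \<open>Otherwise \<open>u\<close> and \<open>v\<close> can be identified: they are not
  adjacent, so no loop arises, and they have equal labels at every common neighbour, so the quotient
  is again a colored mixed graph.\<close>

lemma relative_clique_joined: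
  assumes G: "colored_mixed_graph m n G" and R: "relative_clique m n G R"
    and uv: "u \<in> R" "v \<in> R" "u \<noteq> v"
  shows "lab G u v \<noteq> None \<or> (\<exists>w. lab G w u \<noteq> None \<and> lab G w v \<noteq> None \<and> lab G w u \<noteq> lab G w v)"
proof (rule ccontr)
  assume neg: "\<not> ?thesis"
  note cmg = colored_mixed_graphD[OF G]
  have nadj: "lab G u v = None" "lab G v u = None"
    using neg cmg(3)[where u = u and v = v] by auto
  have agree: "lab G w u = lab G w v" if "lab G w u \<noteq> None" "lab G w v \<noteq> None" for w
    using neg that by blast
  have agree': "lab G u w = lab G v w" if "lab G u w \<noteq> None" "lab G v w \<noteq> None" for w
  proof -
    have "lab G u w = map_option flip_adj (lab G w u)" "lab G v w = map_option flip_adj (lab G w v)"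
      by (rule cmg(3))+
    then show ?thesis using agree[of w] that by simp
  qed
  have loop: "lab G w w = None" for w using cmg(2)[of w w] by blast
  \<comment> \<open>The merged vertex keeps the name \<open>u\<close>; at a common neighbour the
    choice between the two labels does not matter, by \<open>agree\<close> and
    \<open>agree'\<close>.\<close>
  define L where "L = (\<lambda>a b. if a = v \<or> b = v then None
      else if a = u then (if lab G u b = None then lab G v b else lab G u b)
      else if b = u then (if lab G a u = None then lab G a v else lab G a u)
      else lab G a b)"
  define H where "H = \<lparr>verts = verts G - {v}, lab = L\<rparr>"
  have H: "verts H = verts G - {v}" "lab H = L" by (simp_all add: H_def)
  have V: "u \<in> verts G" "v \<in> verts G" using R uv by (auto simp: relative_clique_def)
  have Lsym: "L b a = map_option flip_adj (L a b)" for a b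
  proof -
    consider "a = v \<or> b = v" | "a \<noteq> v" "b \<noteq> v" "a = u" "b = u" | "a \<noteq> v" "b \<noteq> v" "a = u" "b \<noteq> u"
      | "a \<noteq> v" "b \<noteq> v" "a \<noteq> u" "b = u" | "a \<noteq> v" "b \<noteq> v" "a \<noteq> u" "b \<noteq> u" by blast
    then show ?thesis
    proof cases
      case 2
      then show ?thesis using loop nadj by (simp add: L_def)
    next
      case 3
      have "lab G b u = map_option flip_adj (lab G u b)" "lab G b v = map_option flip_adj (lab G v b)"
        by (rule cmg(3))+
      then show ?thesis using 3 by (simp add: L_def)
    next
      case 4
      have "lab G u a = map_option flip_adj (lab G a u)" "lab G v a = map_option flip_adj (lab G a v)"
        by (rule cmg(3))+
      then show ?thesis using 4 by (simp add: L_def)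
    next
      case 5
      have "lab G b a = map_option flip_adj (lab G a b)" by (rule cmg(3))
      then show ?thesis using 5 by (simp add: L_def)
    qed (auto simp: L_def)
  qed
  have Lval: "\<exists>a' b'. L a b = lab G a' b'" if "L a b \<noteq> None" for a b
    using that by (auto simp: L_def split: if_splits)
  have Lin: "a \<in> verts G - {v} \<and> b \<in> verts G - {v} \<and> a \<noteq> b" if "L a b \<noteq> None" for a b
  proof -
    have "a \<noteq> v" "b \<noteq> v" using that by (auto simp: L_def split: if_splits)
    moreover have "a \<in> verts G" "b \<in> verts G"
      using that V cmg(2)[of u b] cmg(2)[of v b] cmg(2)[of a u] cmg(2)[of a v] cmg(2)[of a b]
      by (auto simp: L_def split: if_splits)
    moreover have "a \<noteq> b" using that loop nadj by (auto simp: L_def split: if_splits)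
    ultimately show ?thesis by blast
  qed
  have "colored_mixed_graph m n H"
    unfolding colored_mixed_graph_def
  proof (intro conjI allI impI)
    show "finite (verts H)" using cmg(1) by (simp add: H_def)
    fix a b
    show "lab H b a = map_option flip_adj (lab H a b)" unfolding H by (rule Lsym)
    show "a \<in> verts H" "b \<in> verts H" "a \<noteq> b" if "lab H a b \<noteq> None"
      using Lin[of a b] that unfolding H by auto
    show "i < m" if "lab H a b = Some (Fwd i)" for i
      using that Lval[of a b] cmg(4) unfolding H by auto
    show "j < n" if "lab H a b = Some (Edg j)" for j
      using that Lval[of a b] cmg(5) unfolding H by auto
  qed
  moreover have "colored_hom G H (id(v := u))"
    unfolding colored_hom_def
  proof (intro conjI allI impI)
    show "(id(v := u)) ` verts G \<subseteq> verts H" using V uv by (auto simp: H_def)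
    fix a b t assume t: "lab G a b = Some t"
    have "L ((id(v := u)) a) ((id(v := u)) b) = Some t"
    proof -
      consider "a = v" "b = v" | "a = v" "b \<noteq> v" | "a \<noteq> v" "b = v" | "a \<noteq> v" "b \<noteq> v" by blast
      then show ?thesis
      proof cases
        case 1
        then show ?thesis using t loop by simp
      next
        case 2
        then show ?thesis using t uv nadj agree'[of b] by (auto simp: L_def)
      next
        case 3
        have "lab G u u = None" by (rule loop)
        then show ?thesis using 3 t uv nadj agree[of a] by (auto simp: L_def)
      next
        case 4
        then show ?thesis using t uv agree'[of b] agree[of a] by (auto simp: L_def)
      qed
    qed
    then show "lab H ((id(v := u)) a) ((id(v := u)) b) = Some t" by (simp add: H_def)
  qed
  ultimately have "inj_on (id(v := u)) R" using R by (auto simp: relative_clique_def)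
  then show False using uv by (auto simp: inj_on_def)
qed

section \<open>Adjacency types and the pairs joined by one centre\<close>

definition adjtypes :: "nat \<Rightarrow> nat \<Rightarrow> adjtype set" where
  "adjtypes m n = Fwd ` {..<m} \<union> Bwd ` {..<m} \<union> Edg ` {..<n}"

lemma finite_adjtypes: "finite (adjtypes m n)"
  by (simp add: adjtypes_def)

lemma card_adjtypes: "card (adjtypes m n) = 2 * m + n"
proof -
  have "card (Fwd ` {..<m} \<union> Bwd ` {..<m} \<union> Edg ` {..<n}) = card (Fwd ` {..<m} \<union> Bwd ` {..<m}) + card (Edg ` {..<n})"
    by (rule card_Un_disjoint) auto
  also have "card (Fwd ` {..<m} \<union> Bwd ` {..<m}) = card (Fwd ` {..<m}) + card (Bwd ` {..<m})"
    by (rule card_Un_disjoint) auto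
  finally show ?thesis by (simp add: adjtypes_def card_image inj_on_def)
qed

lemma lab_in_adjtypes:
  assumes "colored_mixed_graph m n G" "lab G u v = Some t"
  shows "t \<in> adjtypes m n"
proof (cases t)
  case (Fwd i)
  then show ?thesis using colored_mixed_graphD(4)[OF assms(1)] assms(2) by (auto simp: adjtypes_def)
next
  case (Bwd i)
  then have "lab G v u = Some (Fwd i)" using colored_mixed_graphD(3)[OF assms(1), of v u] assms(2) by simp
  then show ?thesis using Bwd colored_mixed_graphD(4)[OF assms(1)] by (auto simp: adjtypes_def)
next
  case (Edg j)
  then show ?thesis using colored_mixed_graphD(5)[OF assms(1)] assms(2) by (auto simp: adjtypes_def)
qed

text \<open>Splits a centre with up to four leaves into Y-Delta moves with at most three. Two
  triples of a 4-set miss a single pair, which the third set supplies.\<close>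

lemma three_clusters_cover_pairs:
  assumes "finite D" "card D \<le> 4"
  shows "\<exists>T1 T2 T3. T1 \<subseteq> D \<and> T2 \<subseteq> D \<and> T3 \<subseteq> D \<and> card T1 \<le> 3 \<and> card T2 \<le> 3 \<and> card T3 \<le> 3 \<and>
    (\<forall>u\<in>D. \<forall>v\<in>D. {u, v} \<subseteq> T1 \<or> {u, v} \<subseteq> T2 \<or> {u, v} \<subseteq> T3)"
proof (cases "card D \<le> 3")
  case True
  then show ?thesis by (intro exI[of _ D]) auto
next
  case False
  then have "card D = Suc 3" using assms by simp
  then obtain d E where E: "D = insert d E" "d \<notin> E" "card E = 3" by (metis card_eq_SucD)
  then obtain a b c where abc: "E = {a, b, c}" "a \<noteq> b" "a \<noteq> c" "b \<noteq> c" by (auto simp: card_3_iff)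
  have "card {a, b, c} \<le> 3" "card {b, c, d} \<le> 3" "card {a, d} \<le> 3"
    by (simp_all add: card_insert_if)
  then show ?thesis
    by (intro exI[of _ "{a, b, c}"] exI[of _ "{b, c, d}"] exI[of _ "{a, d}"]) (auto simp: E abc)
qed

text \<open>All of \<open>Q\<close> looks alike from \<open>y\<close>, so its pairs are joined
  without \<open>y\<close> and \<open>card_same_type_bound\<close> applies. If all of
  \<open>Q\<close>, except possibly \<open>z\<close>, is adjacent to \<open>z\<close>, split it by
  the type seen from \<open>z\<close>: inside a class neither \<open>y\<close> nor \<open>z\<close>
  is the centre of a special 2-path.\<close>

lemma card_same_type_neighbours:
  assumes G: "colored_mixed_graph m n G" and K: "\<not> K33_minor (\<lambda>u v. lab G u v \<noteq> None)"
    and R: "relative_clique m n G R" and p: "p = 2 * m + n" "p > 1"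
  shows "card {v \<in> R. lab G y v = Some t} \<le> 5 * p + 7"
proof -
  define A where "A = (\<lambda>u v. lab G u v \<noteq> None)"
  define Q where "Q = {v \<in> R. lab G y v = Some t}"
  note cmg = colored_mixed_graphD[OF G]
  have sym: "A v u" if "A u v" for u v
    using that cmg(3)[where u = u and v = v] by (auto simp: A_def)
  have irr: "\<not> A u u" for u using cmg(2)[of u u] unfolding A_def by blast
  have KA: "\<not> K33_minor A" using K by (simp add: A_def)
  have finR: "finite R" using R cmg(1) finite_subset by (auto simp: relative_clique_def)
  then have finQ: "finite Q" by (simp add: Q_def)
  have hub: "A y u" if "u \<in> Q" for u using that by (simp add: Q_def A_def)
  have joined: "A u v \<or> (\<exists>w. A w u \<and> A w v \<and> lab G w u \<noteq> lab G w v)" if "u \<in> R" "v \<in> R" "u \<noteq> v" for u v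
    using relative_clique_joined[OF G R that] by (auto simp: A_def)
  have joinedQ: "A u v \<or> (\<exists>w. w \<noteq> y \<and> A w u \<and> A w v)" if uv: "u \<in> Q" "v \<in> Q" "u \<noteq> v" for u v
  proof (cases "A u v")
    case False
    then obtain w where "A w u" "A w v" "lab G w u \<noteq> lab G w v" using joined[of u v] uv by (auto simp: Q_def)
    moreover from this have "w \<noteq> y" using uv by (auto simp: Q_def)
    ultimately show ?thesis by blast
  qed simp
  consider "card Q \<le> 17" | z where "z \<noteq> y" "Q \<subseteq> insert z {v. A z v}"
    using card_same_type_bound[where A = A and Q = Q and y = y, OF sym irr KA finQ hub joinedQ] by blast
  then have "card Q \<le> 5 * p + 7"
  proof cases
    case 1
    \<comment> \<open>\<open>17 <= 5 * p + 7\<close> because \<open>p >= 2\<close>.\<close>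
    then show ?thesis using p by linarith
  next
    case (2 z)
    define C where "C = (\<lambda>t'. {v \<in> Q. lab G z v = Some t'})"
    have C5: "card (C t') \<le> 5" for t'
    proof (rule card_two_hub_class_le[where A = A and y = y and z = z, OF sym irr KA])
      show "finite (C t')" using finQ by (simp add: C_def)
      show "y \<noteq> z" using 2 by simp
      show "A y c \<and> A z c" if "c \<in> C t'" for c using that hub by (simp add: C_def A_def)
      show "A u v \<or> (\<exists>w. w \<noteq> y \<and> w \<noteq> z \<and> A w u \<and> A w v)" if uv: "u \<in> C t'" "v \<in> C t'" "u \<noteq> v" for u v
      proof (cases "A u v")
        case False
        then obtain w where "A w u" "A w v" "lab G w u \<noteq> lab G w v"
          using joined[of u v] uv by (auto simp: C_def Q_def)
        moreover from this have "w \<noteq> y" "w \<noteq> z" using uv by (auto simp: C_def Q_def)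
        ultimately show ?thesis by blast
      qed simp
    qed
    have "Q \<subseteq> insert z (\<Union>t'\<in>adjtypes m n. C t')"
    proof
      fix v assume v: "v \<in> Q"
      show "v \<in> insert z (\<Union>t'\<in>adjtypes m n. C t')"
      proof (cases "v = z")
        case False
        then obtain t' where t': "lab G z v = Some t'" using 2(2) v by (auto simp: A_def)
        then have "t' \<in> adjtypes m n" "v \<in> C t'" using lab_in_adjtypes[OF G] v by (auto simp: C_def)
        then show ?thesis by blast
      qed simp
    qed
    then have "card Q \<le> card (insert z (\<Union>t'\<in>adjtypes m n. C t'))"
      by (intro card_mono) (use finQ finite_adjtypes in \<open>auto simp: C_def\<close>)
    also have "\<dots> \<le> Suc (card (\<Union>t'\<in>adjtypes m n. C t'))"
      using finQ by (simp add: card_insert_if finite_adjtypes C_def)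
    also have "card (\<Union>t'\<in>adjtypes m n. C t') \<le> (\<Sum>t'\<in>adjtypes m n. card (C t'))"
      by (rule card_UN_le[OF finite_adjtypes])
    also have "\<dots> \<le> (\<Sum>t'\<in>adjtypes m n. 5)" by (rule sum_mono) (rule C5)
    also have "\<dots> = 5 * p" using card_adjtypes p by simp
    finally show ?thesis by simp
  qed
  then show ?thesis by (simp add: Q_def)
qed

lemma card_special_pairs:
  assumes G: "colored_mixed_graph m n G" and finR: "finite R" and p: "p = 2 * m + n"
    and type: "\<And>t. card {v \<in> R. lab G y v = Some t} \<le> a"
  shows "card {(u, v). u \<in> R \<and> v \<in> R \<and> lab G y u \<noteq> None \<and> lab G y v \<noteq> None \<and> lab G y u \<noteq> lab G y v}
    \<le> card {v \<in> R. lab G y v \<noteq> None} * ((p - 1) * a)"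
proof -
  define D where "D = {v \<in> R. lab G y v \<noteq> None}"
  define F where "F = (\<lambda>u. {v \<in> D. lab G y u \<noteq> lab G y v})"
  have finD: "finite D" using finR by (simp add: D_def)
  have F: "card (F u) \<le> (p - 1) * a" if "u \<in> D" for u
  proof -
    obtain t where t: "lab G y u = Some t" using \<open>u \<in> D\<close> by (auto simp: D_def)
    have "F u \<subseteq> (\<Union>t'\<in>adjtypes m n - {t}. {v \<in> R. lab G y v = Some t'})"
      using t lab_in_adjtypes[OF G] by (fastforce simp: F_def D_def)
    then have "card (F u) \<le> card (\<Union>t'\<in>adjtypes m n - {t}. {v \<in> R. lab G y v = Some t'})"
      by (intro card_mono) (use finR finite_adjtypes in auto)
    also have "\<dots> \<le> (\<Sum>t'\<in>adjtypes m n - {t}. card {v \<in> R. lab G y v = Some t'})"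
      by (rule card_UN_le) (simp add: finite_adjtypes)
    also have "\<dots> \<le> (\<Sum>t'\<in>adjtypes m n - {t}. a)" by (rule sum_mono) (rule type)
    also have "\<dots> = (p - 1) * a"
      using lab_in_adjtypes[OF G t] p by (simp add: card_Diff_singleton card_adjtypes)
    finally show ?thesis .
  qed
  have "{(u, v). u \<in> R \<and> v \<in> R \<and> lab G y u \<noteq> None \<and> lab G y v \<noteq> None \<and> lab G y u \<noteq> lab G y v} = Sigma D F"
    by (auto simp: D_def F_def)
  moreover have "card (Sigma D F) = (\<Sum>u\<in>D. card (F u))"
    using finD by (simp add: F_def)
  moreover have "\<dots> \<le> (\<Sum>u\<in>D. (p - 1) * a)" by (rule sum_mono) (rule F)
  ultimately show ?thesis by (simp add: D_def)
qed

text \<open>Edges inside \<open>S\<close> are discarded before the degree bound is applied. An edge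
  between \<open>R\<close> and \<open>S\<close> is counted from both ends, whence the factor
  2.\<close>

lemma K33_free_weighted_degree_sum:
  assumes sym: "\<And>u v. A u v \<Longrightarrow> A v u" and irr: "\<And>u. \<not> A u u" and K: "\<not> K33_minor A"
    and fin: "finite R" "finite S" and RS: "R \<inter> S = {}" and ne: "R \<noteq> {}"
  shows "(\<Sum>u\<in>R. card {v \<in> R. A u v}) + 2 * (\<Sum>s\<in>S. card {v \<in> R. A s v}) \<le> 8 * (card R + card S)"
proof -
  define B where "B = (\<lambda>u v. A u v \<and> (u \<in> R \<or> v \<in> R))"
  let ?W = "R \<union> S"
  have arith: "h + 2 * g \<le> 8 * (c + d)"
    if "a + 4 \<le> 8 * b" "b = c + d" "a = e + f" "f = g" "e = h + k" "k = g" for a b c d e f g h k :: nat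
    using that by simp
  have "\<not> K33_minor B"
  proof
    assume "K33_minor B"
    then have "K33_minor A" by (rule K33_minor_mono) (simp add: B_def)
    then show False using K by blast
  qed
  then have "(\<Sum>u\<in>?W. card {v \<in> ?W. B u v}) + 4 \<le> 8 * card ?W"
    by (intro K33_free_degree_sum) (use fin ne sym irr in \<open>auto simp: B_def\<close>)
  moreover have "card ?W = card R + card S" using fin RS by (rule card_Un_disjoint)
  moreover have "(\<Sum>u\<in>?W. card {v \<in> ?W. B u v}) = (\<Sum>u\<in>R. card {v \<in> ?W. B u v}) + (\<Sum>u\<in>S. card {v \<in> ?W. B u v})"
    by (rule sum.union_disjoint[OF fin RS])
  moreover have "(\<Sum>u\<in>S. card {v \<in> ?W. B u v}) = (\<Sum>s\<in>S. card {v \<in> R. A s v})"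
    by (rule sum.cong[OF refl], rule arg_cong[of _ _ card]) (use RS in \<open>auto simp: B_def\<close>)
  moreover have "(\<Sum>u\<in>R. card {v \<in> ?W. B u v}) = (\<Sum>u\<in>R. card {v \<in> R. A u v}) + (\<Sum>u\<in>R. card {s \<in> S. A u s})"
    unfolding sum.distrib[symmetric]
  proof (rule sum.cong[OF refl])
    fix u assume "u \<in> R"
    then have "{v \<in> ?W. B u v} = {v \<in> R. A u v} \<union> {s \<in> S. A u s}" by (auto simp: B_def)
    then show "card {v \<in> ?W. B u v} = card {v \<in> R. A u v} + card {s \<in> S. A u s}"
      using card_Un_disjoint[of "{v \<in> R. A u v}" "{s \<in> S. A u s}"] fin RS by auto
  qed
  moreover have "(\<Sum>u\<in>R. card {s \<in> S. A u s}) = (\<Sum>s\<in>S. card {v \<in> R. A s v})"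
  proof -
    have "(\<Sum>u\<in>R. card {s \<in> S. A u s}) = (\<Sum>u\<in>R. \<Sum>s\<in>S. if A u s then 1 else 0)"
      using fin by (simp add: sum.inter_filter[symmetric])
    also have "\<dots> = (\<Sum>s\<in>S. \<Sum>u\<in>R. if A u s then 1 else 0)" by (rule sum.swap)
    also have "\<dots> = (\<Sum>s\<in>S. card {u \<in> R. A u s})"
      using fin by (simp add: sum.inter_filter[symmetric])
    also have "\<dots> = (\<Sum>s\<in>S. card {v \<in> R. A s v})"
      by (rule sum.cong[OF refl], rule arg_cong[of _ _ card]) (use sym in blast)
    finally show ?thesis .
  qed
  ultimately show ?thesis by (rule arith)
qed

lemma card_cluster_pairs:
  assumes sym: "\<And>u v. A u v \<Longrightarrow> A v u" and K: "\<not> K33_minor A"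
    and finR: "finite R" and SR: "S \<inter> R = {}"
    and tau: "\<And>s. s \<in> S \<Longrightarrow> finite (\<tau> s) \<and> card (\<tau> s) \<le> 3 \<and> \<tau> s \<subseteq> R \<and> (\<forall>v\<in>\<tau> s. A s v)"
  shows "card {(u, v). u \<in> R \<and> v \<in> R \<and> u \<noteq> v \<and> (A u v \<or> (\<exists>s\<in>S. u \<in> \<tau> s \<and> v \<in> \<tau> s))} \<le> 8 * card R"
proof (cases "R = {}")
  case False
  define B where "B = (\<lambda>u v. u \<in> R \<and> v \<in> R \<and> u \<noteq> v \<and> (A u v \<or> (\<exists>s\<in>S. u \<in> \<tau> s \<and> v \<in> \<tau> s)))"
  have "\<not> K33_minor B"
    unfolding B_def using K33_minor_Y_Delta[where A = A and S = S and \<tau> = \<tau> and R = R, OF sym tau SR] K by blast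
  then have "(\<Sum>u\<in>R. card {v \<in> R. B u v}) + 4 \<le> 8 * card R"
    by (intro K33_free_degree_sum finR False) (use sym in \<open>auto simp: B_def\<close>)
  moreover have "{(u, v). B u v} = Sigma R (\<lambda>u. {v \<in> R. B u v})" by (auto simp: B_def)
  moreover have "card (Sigma R (\<lambda>u. {v \<in> R. B u v})) = (\<Sum>u\<in>R. card {v \<in> R. B u v})"
    using finR by simp
  ultimately show ?thesis unfolding B_def by simp
qed simp

text \<open>A centre of degree \<open>d\<close> earns \<open>2 d q\<close> and must pay its pairs
  and the charge \<open>8 q\<close>. From \<open>d = 8\<close> on the bound \<open>d q\<close> on
  the pairs suffices; for 5, 6 and 7 the trivial bound \<open>d (d - 1)\<close> is small enough
  against \<open>q >= 17\<close>.\<close>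

lemma high_degree_weight:
  fixes d c q :: nat
  assumes "c \<le> d * q" "c \<le> d * (d - 1)" "5 \<le> d" "17 \<le> q"
  shows "c + 8 * q \<le> 2 * d * q"
proof (cases "8 \<le> d")
  case True
  then have "8 * q \<le> d * q" by (rule mult_right_mono) simp
  moreover have "2 * d * q = d * q + d * q" by simp
  ultimately show ?thesis using assms(1) by linarith
next
  case False
  then have "d = 5 \<or> d = 6 \<or> d = 7" using assms(3) by linarith
  then show ?thesis using assms by auto
qed

theorem relative_clique_card_bound:
  assumes G: "colored_mixed_graph m n G" and K: "\<not> K33_minor (\<lambda>u v. lab G u v \<noteq> None)"
    and R: "relative_clique m n G R" and p: "p = 2 * m + n" "p > 1"
  shows "card R \<le> 8 * ((p - 1) * (5 * p + 7)) + 25"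
proof (cases "R = {}")
  case False
  define A where "A = (\<lambda>u v. lab G u v \<noteq> None)"
  define q where "q = (p - 1) * (5 * p + 7)"
  note cmg = colored_mixed_graphD[OF G]
  have sym: "A v u" if "A u v" for u v
    using that cmg(3)[where u = u and v = v] by (auto simp: A_def)
  have irr: "\<not> A u u" for u using cmg(2)[of u u] unfolding A_def by blast
  have KA: "\<not> K33_minor A" using K by (simp add: A_def)
  have RV: "R \<subseteq> verts G" using R by (auto simp: relative_clique_def)
  then have finR: "finite R" using cmg(1) finite_subset by blast
  have q17: "17 \<le> q"
  proof -
    have "1 * 17 \<le> (p - 1) * (5 * p + 7)" using p(2) by (intro mult_mono) auto
    then show ?thesis by (simp add: q_def)
  qed
  define D where "D = (\<lambda>s. {v \<in> R. A s v})"
  have finD: "finite (D s)" for s using finR by (simp add: D_def)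
  define S where "S = {s \<in> verts G - R. card (D s) \<le> 4}"
  define L where "L = {s \<in> verts G - R. 5 \<le> card (D s)}"
  have finL: "finite L" using cmg(1) by (simp add: L_def)
  have SR: "S \<inter> R = {}" and RL: "R \<inter> L = {}" by (auto simp: S_def L_def)
  have "\<exists>T1 T2 T3. T1 \<subseteq> D s \<and> T2 \<subseteq> D s \<and> T3 \<subseteq> D s \<and> card T1 \<le> 3 \<and> card T2 \<le> 3 \<and> card T3 \<le> 3 \<and>
    (\<forall>u\<in>D s. \<forall>v\<in>D s. {u, v} \<subseteq> T1 \<or> {u, v} \<subseteq> T2 \<or> {u, v} \<subseteq> T3)" if "s \<in> S" for s
    using that by (intro three_clusters_cover_pairs finD) (simp add: S_def)
  then obtain T1 T2 T3 where T: "\<And>s. s \<in> S \<Longrightarrow> T1 s \<subseteq> D s \<and> T2 s \<subseteq> D s \<and> T3 s \<subseteq> D s \<and>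
      card (T1 s) \<le> 3 \<and> card (T2 s) \<le> 3 \<and> card (T3 s) \<le> 3 \<and>
      (\<forall>u\<in>D s. \<forall>v\<in>D s. {u, v} \<subseteq> T1 s \<or> {u, v} \<subseteq> T2 s \<or> {u, v} \<subseteq> T3 s)"
    by metis
  define E where "E = (\<lambda>\<tau>. {(u, v). u \<in> R \<and> v \<in> R \<and> u \<noteq> v \<and> (A u v \<or> (\<exists>s\<in>S. u \<in> \<tau> s \<and> v \<in> \<tau> s))})"
  have E: "card (E \<tau>) \<le> 8 * card R" if "\<And>s. s \<in> S \<Longrightarrow> \<tau> s \<subseteq> D s \<and> card (\<tau> s) \<le> 3" for \<tau>
    unfolding E_def
  proof (rule card_cluster_pairs[OF sym KA finR SR])
    fix s assume "s \<in> S"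
    then show "finite (\<tau> s) \<and> card (\<tau> s) \<le> 3 \<and> \<tau> s \<subseteq> R \<and> (\<forall>v\<in>\<tau> s. A s v)"
      using that[of s] finite_subset[OF _ finD, of "\<tau> s" s] by (auto simp: D_def)
  qed
  define P where "P = (\<lambda>y. {(u, v). u \<in> R \<and> v \<in> R \<and> lab G y u \<noteq> None \<and> lab G y v \<noteq> None \<and> lab G y u \<noteq> lab G y v})"
  have PD: "P y \<subseteq> Sigma (D y) (\<lambda>u. D y - {u})" for y by (auto simp: P_def D_def A_def)
  have Pq: "card (P y) \<le> card (D y) * q" for y
    unfolding P_def D_def A_def q_def
    by (rule card_special_pairs[OF G finR p(1) card_same_type_neighbours[OF G K R p]])
  have Pd: "card (P y) \<le> card (D y) * (card (D y) - 1)" for y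
  proof -
    have "card (P y) \<le> card (Sigma (D y) (\<lambda>u. D y - {u}))" by (rule card_mono[OF _ PD]) (use finD in auto)
    also have "\<dots> = (\<Sum>u\<in>D y. card (D y - {u}))" using finD by simp
    also have "\<dots> = (\<Sum>u\<in>D y. card (D y) - 1)" by (rule sum.cong) (use finD in auto)
    finally show ?thesis by simp
  qed
  have finP: "finite (P y)" for y by (rule finite_subset[OF PD]) (use finD in auto)
  have finE: "finite (E \<tau>)" for \<tau>
    by (rule finite_subset[of _ "R \<times> R"]) (use finR in \<open>auto simp: E_def\<close>)
  let ?X = "Sigma R (\<lambda>u. R - {u})"
  \<comment> \<open>Adjacent pairs lie in \<open>E T1\<close>, pairs joined through an outer centre
    of low degree in one of the three \<open>E\<close>, all others in the \<open>P\<close> of their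
    centre.\<close>
  have "?X \<subseteq> E T1 \<union> E T2 \<union> E T3 \<union> (\<Union>y\<in>R. P y) \<union> (\<Union>y\<in>L. P y)"
  proof
    fix x assume "x \<in> ?X"
    then obtain u v where x: "x = (u, v)" "u \<in> R" "v \<in> R" "u \<noteq> v" by auto
    show "x \<in> E T1 \<union> E T2 \<union> E T3 \<union> (\<Union>y\<in>R. P y) \<union> (\<Union>y\<in>L. P y)"
    proof (cases "A u v")
      case True
      then show ?thesis using x by (auto simp: E_def)
    next
      case False
      then obtain w where w: "lab G w u \<noteq> None" "lab G w v \<noteq> None" "lab G w u \<noteq> lab G w v"
        using relative_clique_joined[OF G R x(2,3,4)] by (auto simp: A_def)
      have xP: "x \<in> P w" using x w by (simp add: P_def)
      have wV: "w \<in> verts G" using cmg(2)[OF w(1)] by blast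
      show ?thesis
      proof (cases "w \<in> R \<or> w \<in> L")
        case True
        then show ?thesis using xP by blast
      next
        case False
        then have wS: "w \<in> S" using wV by (auto simp: S_def L_def)
        have uvD: "u \<in> D w" "v \<in> D w" using x w by (auto simp: D_def A_def)
        have "\<forall>u\<in>D w. \<forall>v\<in>D w. {u, v} \<subseteq> T1 w \<or> {u, v} \<subseteq> T2 w \<or> {u, v} \<subseteq> T3 w"
          using T[OF wS] by (elim conjE)
        then have "{u, v} \<subseteq> T1 w \<or> {u, v} \<subseteq> T2 w \<or> {u, v} \<subseteq> T3 w" using uvD by blast
        then show ?thesis using x wS by (auto simp: E_def)
      qed
    qed
  qed
  then have "card ?X \<le> card (E T1 \<union> E T2 \<union> E T3 \<union> (\<Union>y\<in>R. P y) \<union> (\<Union>y\<in>L. P y))"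
    by (rule card_mono[rotated]) (use finE finP finR finL in auto)
  also have "\<dots> \<le> card (E T1) + card (E T2) + card (E T3) + card (\<Union>y\<in>R. P y) + card (\<Union>y\<in>L. P y)"
    by (meson add_le_mono1 card_Un_le order_trans)
  also have "\<dots> \<le> 24 * card R + (\<Sum>y\<in>R. card (P y)) + (\<Sum>y\<in>L. card (P y))"
  proof -
    have "card (E T1) \<le> 8 * card R" "card (E T2) \<le> 8 * card R" "card (E T3) \<le> 8 * card R"
      by (rule E, drule T, simp)+
    then show ?thesis using card_UN_le[OF finR, of P] card_UN_le[OF finL, of P] by linarith
  qed
  finally have X: "card ?X \<le> 24 * card R + (\<Sum>y\<in>R. card (P y)) + (\<Sum>y\<in>L. card (P y))" .
  have "(\<Sum>y\<in>R. card (P y)) \<le> (\<Sum>y\<in>R. card (D y)) * q"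
    unfolding sum_distrib_right by (rule sum_mono) (rule Pq)
  moreover have "(\<Sum>y\<in>L. card (P y)) + 8 * card L * q \<le> 2 * (\<Sum>y\<in>L. card (D y)) * q"
  proof -
    have "(\<Sum>y\<in>L. card (P y) + 8 * q) \<le> (\<Sum>y\<in>L. 2 * card (D y) * q)"
      by (rule sum_mono) (use high_degree_weight[OF Pq Pd _ q17] in \<open>auto simp: L_def\<close>)
    then show ?thesis by (simp add: sum.distrib sum_distrib_left sum_distrib_right mult_ac)
  qed
  \<comment> \<open>The charge \<open>8 * card L * q\<close> appears on both sides, so
    \<open>card L\<close> drops out of the estimate.\<close>
  moreover have "((\<Sum>y\<in>R. card (D y)) + 2 * (\<Sum>y\<in>L. card (D y))) * q \<le> 8 * (card R + card L) * q"
    using K33_free_weighted_degree_sum[where A = A, OF sym irr KA finR finL RL False]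
    by (intro mult_right_mono) (simp_all add: D_def)
  ultimately have "card ?X \<le> 24 * card R + 8 * card R * q"
    using X by (simp add: algebra_simps)
  moreover have "card ?X = card R * (card R - 1)"
    using finR by simp
  ultimately have "card R * (card R - 1) \<le> card R * (24 + 8 * q)" by (simp add: algebra_simps)
  moreover have "0 < card R" using False finR by (simp add: card_gt_0_iff)
  ultimately have "card R - 1 \<le> 24 + 8 * q" by simp
  then show ?thesis by (simp add: q_def)
qed simp

theorem planar_relative_clique_bound:
  assumes G: "colored_mixed_graph m n G" and pl: "planar (verts G) (underlying_edges G)"
    and R: "relative_clique m n G R" and p: "p = 2 * m + n" "p > 1"
  shows "card R \<le> 42 * p\<^sup>2 + 8"
proof -
  have "{u, v} \<in> underlying_edges G \<longleftrightarrow> lab G u v \<noteq> None" for u v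
    using colored_mixed_graphD(3)[OF G, where u = u and v = v]
    by (cases "lab G u v") (auto simp: underlying_edges_def doubleton_eq_iff)
  then have "\<not> K33_minor (\<lambda>u v. lab G u v \<noteq> None)"
    using planar_no_K33_minor[OF pl] by simp
  then have "card R \<le> 8 * ((p - 1) * (5 * p + 7)) + 25"
    by (rule relative_clique_card_bound[OF G _ R p])
  also have "\<dots> \<le> 42 * p\<^sup>2 + 8"
  proof -
    \<comment> \<open>The substitution removes the truncated \<open>p - 1\<close>; the remaining
      slack is \<open>2 k^2 - 8 k + 15 = 2 (k - 2)^2 + 7\<close>.\<close>
    obtain k where k: "p = k + 2" using p(2) by (metis Suc_1 Suc_leI add.commute le_Suc_ex)
    have "8 * k \<le> 2 * k\<^sup>2 + 15"
    proof -
      have "0 \<le> (int k - 2)\<^sup>2" by simp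
      then have "int (8 * k) \<le> int (2 * k\<^sup>2 + 15)" by (simp add: power2_eq_square algebra_simps)
      then show ?thesis by (simp only: of_nat_le_iff)
    qed
    then show ?thesis by (simp add: k power2_eq_square algebra_simps)
  qed
  finally show ?thesis .
qed

section \<open>The lower bound\<close>

text \<open>\<open>(b - X) * (X - a)\<close> is the height over the parabola, at abscissa
  \<open>X\<close>, of the chord from \<open>a\<close> to \<open>b\<close>; \<open>eq\<close> thus
  says that two chords meet there.\<close>

lemma chords_meet_at_common_ends:
  fixes a b c d X :: real
  assumes ab: "a < b" and cd: "c < d" and ne: "(a, b) \<noteq> (c, d)"
    and X: "a \<le> X" "X \<le> b" "c \<le> X" "X \<le> d"
    and eq: "(b - X) * (X - a) = (d - X) * (X - c)"
    and pos: "b \<le> c \<or> d \<le> a \<or> a \<le> c \<and> d \<le> b \<or> c \<le> a \<and> b \<le> d"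
  shows "(X = a \<or> X = b) \<and> (X = c \<or> X = d)"
proof -
  have nested: "(X = a \<or> X = b) \<and> (X = c \<or> X = d)"
    if ab: "a < b" and cd: "c < d" and ne: "(a, b) \<noteq> (c, d)" and X: "c \<le> X" "X \<le> d"
      and eq: "(b - X) * (X - a) = (d - X) * (X - c)" and nest: "a \<le> c" "d \<le> b" for a b c d :: real
  proof -
    let ?s = "(b - c) * (c - a) * (d - X)" and ?t = "(b - d) * (d - a) * (X - c)"
    \<comment> \<open>The quadratic terms cancel, so the height difference is affine in
      \<open>X\<close>; the left side interpolates it from its values at \<open>c\<close> and
      \<open>d\<close>, which are nonnegative by nesting.\<close>
    have "?s + ?t = (d - c) * ((b - X) * (X - a) - (d - X) * (X - c))"
      by (simp add: algebra_simps)
    then have "?s + ?t = 0" using eq by simp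
    moreover have "0 \<le> ?s" "0 \<le> ?t" using ab cd X nest by simp_all
    ultimately have "?s = 0" "?t = 0" by linarith+
    then show ?thesis using ab cd X nest ne by auto
  qed
  show ?thesis
    using pos
  proof (elim disjE conjE)
    assume "a \<le> c" "d \<le> b"
    then show ?thesis using nested[OF ab cd ne X(3,4) eq] by blast
  next
    assume "c \<le> a" "b \<le> d"
    then show ?thesis using nested[OF cd ab ne[symmetric] X(1,2) eq[symmetric]] by blast
  qed (use X ab cd in auto)
qed

text \<open>Chords of the parabola lie on or above it. The line from \<open>(0, -M)\<close> through
  \<open>(k, k^2)\<close> meets the parabola again at abscissa \<open>M / k\<close>; with
  \<open>M > N^2\<close> this is beyond \<open>N\<close>, so a spoke stays below the parabola up to
  its end.\<close>

lemma planar_apex_over_noncrossing_chords: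
  fixes C :: "(nat \<times> nat) set"
  assumes C: "\<And>a b. (a, b) \<in> C \<Longrightarrow> 1 \<le> a \<and> a < b \<and> b \<le> N"
    and nc: "\<And>a b c d. (a, b) \<in> C \<Longrightarrow> (c, d) \<in> C \<Longrightarrow> \<not> (a < c \<and> c < b \<and> b < d)"
  shows "planar {0..N} ({{0, k} | k. 1 \<le> k \<and> k \<le> N} \<union> {{a, b} | a b. (a, b) \<in> C})" (is "planar _ ?E")
proof -
  define M :: real where "M = (real N)\<^sup>2 + 1"
  define P :: "nat \<Rightarrow> real^2" where "P = (\<lambda>k. if k = 0 then vector [0, - M] else vector [real k, (real k)\<^sup>2])"
  have P0: "P 0 $ 1 = 0" "P 0 $ 2 = - M" by (simp_all add: P_def)
  have P: "P k $ 1 = real k" "P k $ 2 = (real k)\<^sup>2" if "1 \<le> k" for k using that by (simp_all add: P_def)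
  have P1: "P k $ 1 = real k" for k using P0 P by (cases "k = 0") auto
  have Pinj: "P k = P l \<longleftrightarrow> k = l" for k l by (metis P1 of_nat_eq_iff)
  have eqP: "x = P k" if "x $ 1 = P k $ 1" "x $ 2 = P k $ 2" for x k
    using that by (simp add: vec_eq_iff forall_2)
  have Mkl: "real k * real l < M" if "k \<le> N" "l \<le> N" for k l
  proof -
    have "real k * real l \<le> real N * real N" using that by (intro mult_mono) auto
    then show ?thesis by (simp add: M_def power2_eq_square)
  qed
  have chord: "real a \<le> x $ 1 \<and> x $ 1 \<le> real b \<and> x $ 2 - (x $ 1)\<^sup>2 = (real b - x $ 1) * (x $ 1 - real a)"
    if ab: "(a, b) \<in> C" and seg: "x \<in> closed_segment (P a) (P b)" for a b x
  proof -
    obtain u where u: "0 \<le> u" "u \<le> 1" and x: "x = (1 - u) *\<^sub>R P a + u *\<^sub>R P b"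
      using seg by (auto simp: in_segment)
    have ab: "1 \<le> a" "1 \<le> b" "a < b" using C[OF ab] by auto
    have x1: "x $ 1 = real a + u * (real b - real a)" and x2: "x $ 2 = (1 - u) * (real a)\<^sup>2 + u * (real b)\<^sup>2"
      using ab P by (simp_all add: x algebra_simps)
    have "0 \<le> u * (real b - real a)" using u ab by simp
    then have "real a \<le> x $ 1" unfolding x1 by linarith
    have "0 \<le> (1 - u) * (real b - real a)" using u ab by simp
    then have "x $ 1 \<le> real b" unfolding x1 by (simp add: algebra_simps)
    moreover have "x $ 2 - (x $ 1)\<^sup>2 = (real b - x $ 1) * (x $ 1 - real a)"
      unfolding x1 x2 by (simp add: power2_eq_square algebra_simps)
    ultimately show ?thesis using \<open>real a \<le> x $ 1\<close> by blast
  qed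
  have spoke: "0 \<le> x $ 1 \<and> x $ 1 \<le> real k \<and> real k * (x $ 2 - (x $ 1)\<^sup>2) = - ((real k - x $ 1) * (M - real k * x $ 1))"
    if k: "1 \<le> k" "k \<le> N" and seg: "x \<in> closed_segment (P 0) (P k)" for k x
  proof -
    obtain u where u: "0 \<le> u" "u \<le> 1" and x: "x = (1 - u) *\<^sub>R P 0 + u *\<^sub>R P k"
      using seg by (auto simp: in_segment)
    have x1: "x $ 1 = u * real k" and x2: "x $ 2 = - (1 - u) * M + u * (real k)\<^sup>2"
      using P[OF k(1)] P0 by (simp_all add: x algebra_simps)
    have "u * real k \<le> 1 * real k" using u by (intro mult_right_mono) auto
    then have "0 \<le> x $ 1" "x $ 1 \<le> real k" unfolding x1 using u by auto
    moreover have "real k * (x $ 2 - (x $ 1)\<^sup>2) = - ((real k - x $ 1) * (M - real k * x $ 1))"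
      unfolding x1 x2 by (simp add: power2_eq_square algebra_simps)
    ultimately show ?thesis by blast
  qed
  have below: "real k * x $ 1 < M" if "1 \<le> k" "k \<le> N" "x $ 1 \<le> real k" for k and x :: "real^2"
  proof -
    have "real k * x $ 1 \<le> real k * real k" using that by (intro mult_left_mono) auto
    then show ?thesis using Mkl[of k k] that by linarith
  qed
  have spoke_end: "x = P k" if k: "1 \<le> k" "k \<le> N" and x: "x \<in> closed_segment (P 0) (P k)" and "(x $ 1)\<^sup>2 \<le> x $ 2" for k x
  proof -
    note s = spoke[OF k x]
    have "0 \<le> real k * (x $ 2 - (x $ 1)\<^sup>2)" using that by simp
    moreover have "0 < M - real k * x $ 1" using below[OF k] s by auto
    moreover have "0 \<le> real k - x $ 1" using s by auto
    ultimately have "real k - x $ 1 = 0"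
      using s by (metis add.inverse_inverse le_minus_iff mult_pos_pos neg_0_le_iff_le not_less order_le_less)
    then have x1: "x $ 1 = real k" by simp
    then have "real k * (x $ 2 - (x $ 1)\<^sup>2) = 0" using s by simp
    then have "x $ 2 = (real k)\<^sup>2" using k x1 by simp
    then show ?thesis using x1 P k by (intro eqP) auto
  qed
  have chord_spoke: "\<exists>l\<in>{a, b}. l = k \<and> x = P l"
    if ab: "(a, b) \<in> C" "x \<in> closed_segment (P a) (P b)" and k: "1 \<le> k" "k \<le> N" "x \<in> closed_segment (P 0) (P k)" for a b k x
  proof -
    note c = chord[OF ab]
    have "0 \<le> (real b - x $ 1) * (x $ 1 - real a)" using c by simp
    then have "x = P k" using c by (intro spoke_end[OF k]) linarith
    moreover from this have "(real b - real k) * (real k - real a) = 0" using c P[OF k(1)] by simp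
    ultimately show ?thesis by auto
  qed
  have spokes: "x = P 0" if k: "1 \<le> k" "k \<le> N" "x \<in> closed_segment (P 0) (P k)"
    and l: "1 \<le> l" "l \<le> N" "x \<in> closed_segment (P 0) (P l)" and kl: "k \<noteq> l" for k l x
  proof -
    obtain u where x: "x = (1 - u) *\<^sub>R P 0 + u *\<^sub>R P k" using k(3) by (auto simp: in_segment)
    obtain v where x': "x = (1 - v) *\<^sub>R P 0 + v *\<^sub>R P l" using l(3) by (auto simp: in_segment)
    have "x $ 1 = u * real k" "x $ 2 = u * (M + (real k)\<^sup>2) - M" using P[OF k(1)] P0 by (simp_all add: x algebra_simps)
    moreover have "x $ 1 = v * real l" "x $ 2 = v * (M + (real l)\<^sup>2) - M" using P[OF l(1)] P0 by (simp_all add: x' algebra_simps)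
    ultimately have 1: "u * real k = v * real l" and 2: "u * (M + (real k)\<^sup>2) = v * (M + (real l)\<^sup>2)" by auto
    \<comment> \<open>Eliminates \<open>v\<close>: for \<open>k\<close> and \<open>l\<close>
      different, two spokes span the same line only if \<open>M = k l\<close>, which the size of
      \<open>M\<close> excludes.\<close>
    have "u * ((real l - real k) * (M - real k * real l)) = real l * (u * (M + (real k)\<^sup>2)) - (u * real k) * (M + (real l)\<^sup>2)"
      by (simp add: power2_eq_square algebra_simps)
    also have "\<dots> = 0" unfolding 1 2 by simp
    finally have "u = 0" using kl Mkl[OF k(2) l(2)] by auto
    then show ?thesis using x by simp
  qed
  have chords: "\<exists>l\<in>{a, b} \<inter> {c, d}. x = P l"
    if ab: "(a, b) \<in> C" "x \<in> closed_segment (P a) (P b)" and cd: "(c, d) \<in> C" "x \<in> closed_segment (P c) (P d)"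
      and ne: "(a, b) \<noteq> (c, d)" for a b c d x
  proof -
    note s = chord[OF ab] and t = chord[OF cd]
    have ord: "a < b" "c < d" "1 \<le> a" "1 \<le> c" using C[OF ab(1)] C[OF cd(1)] by auto
    have "b \<le> c \<or> d \<le> a \<or> a \<le> c \<and> d \<le> b \<or> c \<le> a \<and> b \<le> d"
      using nc[OF ab(1) cd(1)] nc[OF cd(1) ab(1)] by linarith
    then have "real b \<le> real c \<or> real d \<le> real a \<or> real a \<le> real c \<and> real d \<le> real b \<or> real c \<le> real a \<and> real b \<le> real d"
      by auto
    then have e: "(x $ 1 = real a \<or> x $ 1 = real b) \<and> (x $ 1 = real c \<or> x $ 1 = real d)"
      using chords_meet_at_common_ends[of "real a" "real b" "real c" "real d" "x $ 1"] s t ord ne by auto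
    then obtain l where l: "l \<in> {a, b} \<inter> {c, d}" "x $ 1 = real l" by auto
    have "x $ 2 = (real l)\<^sup>2" using s e l(2) by auto
    moreover have "1 \<le> l" using l ord by auto
    ultimately have "x = P l" using P l(2) by (intro eqP) auto
    then show ?thesis using l by blast
  qed
  define \<gamma> where "\<gamma> = (\<lambda>e::nat set. linepath (P (Min e)) (P (Max e)))"
  have edge: "\<exists>a b. e = {a, b} \<and> a < b \<and> b \<le> N \<and> Min e = a \<and> Max e = b \<and> (a = 0 \<or> (a, b) \<in> C)" if e: "e \<in> ?E" for e
  proof -
    consider k where "e = {0, k}" "1 \<le> k" "k \<le> N" | a b where "e = {a, b}" "(a, b) \<in> C" using e by blast
    then show ?thesis
    proof cases
      case (1 k)
      then show ?thesis by (intro exI[of _ 0] exI[of _ k]) auto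
    next
      case (2 a b)
      then show ?thesis using C[OF 2(2)] by (intro exI[of _ a] exI[of _ b]) auto
    qed
  qed
  show ?thesis
    unfolding planar_def
  proof (intro conjI exI[of _ P] exI[of _ \<gamma>] ballI impI)
    show "simple_graph {0..N} ?E"
      unfolding simple_graph_def
    proof (intro conjI ballI)
      fix e assume e: "e \<in> ?E"
      obtain a b where ab: "e = {a, b}" "a < b" "b \<le> N" "Min e = a" "Max e = b" "a = 0 \<or> (a, b) \<in> C"
        using edge[OF e] by (elim exE conjE)
      then show "\<exists>u v. u \<noteq> v \<and> u \<in> {0..N} \<and> v \<in> {0..N} \<and> e = {u, v}"
        by (intro exI[of _ a] exI[of _ b]) auto
    qed simp
    show "inj_on P {0..N}" using Pinj by (simp add: inj_on_def)
    fix e assume e: "e \<in> ?E"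
    obtain a b where ab: "e = {a, b}" "a < b" "b \<le> N" "Min e = a" "Max e = b" "a = 0 \<or> (a, b) \<in> C"
      using edge[OF e] by (elim exE conjE)
    have ge: "\<gamma> e = linepath (P a) (P b)" using ab by (simp add: \<gamma>_def)
    show "arc (\<gamma> e)" unfolding ge using ab Pinj by (intro arc_linepath) auto
    show "{pathstart (\<gamma> e), pathfinish (\<gamma> e)} = P ` e" unfolding ge by (simp add: ab(1))
    show "path_image (\<gamma> e) \<inter> P ` {0..N} \<subseteq> P ` e"
    proof
      fix x assume "x \<in> path_image (\<gamma> e) \<inter> P ` {0..N}"
      then obtain c where c: "x = P c" "c \<le> N" "P c \<in> closed_segment (P a) (P b)" by (auto simp: ge)
      have "c \<in> e"
      proof (cases "a = 0")
        case True
        then have b: "1 \<le> b" "b \<le> N" "P c \<in> closed_segment (P 0) (P b)" using ab c by auto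
        show ?thesis
        proof (cases "c = 0")
          case False
          then have "P c = P b" using P by (intro spoke_end[OF b]) auto
          then show ?thesis using Pinj ab by auto
        qed (use ab True in auto)
      next
        case False
        then have C': "(a, b) \<in> C" using ab by auto
        note ch = chord[OF C' c(3)]
        have "c \<noteq> 0" using ch P1[of c] False by auto
        then have "(real b - real c) * (real c - real a) = 0" using ch P[of c] by simp
        then show ?thesis using ab by auto
      qed
      then show "x \<in> P ` e" using c by blast
    qed
    fix e' assume e': "e' \<in> ?E" "e \<noteq> e'"
    obtain c d where cd: "e' = {c, d}" "c < d" "d \<le> N" "Min e' = c" "Max e' = d" "c = 0 \<or> (c, d) \<in> C"
      using edge[OF e'(1)] by (elim exE conjE)
    have ge': "\<gamma> e' = linepath (P c) (P d)" using cd by (simp add: \<gamma>_def)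
    show "path_image (\<gamma> e) \<inter> path_image (\<gamma> e') \<subseteq> P ` (e \<inter> e')"
    proof
      fix x assume "x \<in> path_image (\<gamma> e) \<inter> path_image (\<gamma> e')"
      then have x: "x \<in> closed_segment (P a) (P b)" "x \<in> closed_segment (P c) (P d)" by (auto simp: ge ge')
      have ne: "(a, b) \<noteq> (c, d)" using e' ab cd by auto
      consider "a = 0" "c = 0" | "a = 0" "(c, d) \<in> C" | "(a, b) \<in> C" "c = 0" | "(a, b) \<in> C" "(c, d) \<in> C"
        using ab cd by blast
      then show "x \<in> P ` (e \<inter> e')"
      proof cases
        case 1
        then have "x = P 0" using ab cd x ne by (intro spokes[of b x d]) auto
        then show ?thesis using 1 ab cd by auto
      next
        case 2
        then have "\<exists>l\<in>{c, d}. l = b \<and> x = P l" using ab cd x by (intro chord_spoke) auto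
        then show ?thesis using ab cd by auto
      next
        case 3
        then have "\<exists>l\<in>{a, b}. l = d \<and> x = P l" using ab cd x by (intro chord_spoke) auto
        then show ?thesis using ab cd by auto
      next
        case 4
        then have "\<exists>l\<in>{a, b} \<inter> {c, d}. x = P l" using x ne by (intro chords) auto
        then show ?thesis unfolding ab(1) cd(1) by blast
      qed
    qed
  qed
qed

section \<open>The fan graph and its relative clique\<close>

lemma flip_adj_involution [simp]: "flip_adj (flip_adj t) = t"
  by (cases t) auto

text \<open>If \<open>f u = f v\<close>, the image of \<open>w\<close> would carry two labels
  towards one vertex, and an edge between \<open>u\<close> and \<open>v\<close> would become a
  loop.\<close>

lemma relative_cliqueI:
  assumes G: "colored_mixed_graph m n G" and R: "R \<subseteq> verts G"
    and joined: "\<And>u v. u \<in> R \<Longrightarrow> v \<in> R \<Longrightarrow> u < v \<Longrightarrow>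
      lab G u v \<noteq> None \<or> (\<exists>w. lab G w u \<noteq> None \<and> lab G w v \<noteq> None \<and> lab G w u \<noteq> lab G w v)"
  shows "relative_clique m n G R"
  unfolding relative_clique_def
proof (intro conjI R allI impI)
  fix H f assume H: "colored_mixed_graph m n H \<and> colored_hom G H f"
  have loop: "lab H x x = None" for x
    using colored_mixed_graphD(2)[of m n H x x] H by blast
  have hom: "lab H (f a) (f b) = lab G a b" if "lab G a b \<noteq> None" for a b
    using H that unfolding colored_hom_def by fastforce
  have "f u \<noteq> f v" if "u \<in> R" "v \<in> R" "u < v" for u v
  proof
    assume eq: "f u = f v"
    consider "lab G u v \<noteq> None" | w where "lab G w u \<noteq> None" "lab G w v \<noteq> None" "lab G w u \<noteq> lab G w v"
      using joined[OF \<open>u \<in> R\<close> \<open>v \<in> R\<close> \<open>u < v\<close>] by blast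
    then show False
    proof cases
      case 1
      then show False using hom[OF 1] eq loop by metis
    next
      case (2 w)
      then show False using hom[OF 2(1)] hom[OF 2(2)] eq by metis
    qed
  qed
  then show "inj_on f R" by (rule linorder_inj_onI')
qed

text \<open>Enumerates the \<open>p\<close> types by a single index, so that the construction does
  not depend on how \<open>p\<close> splits into arcs and edges.\<close>

definition atype :: "nat \<Rightarrow> nat \<Rightarrow> adjtype" where
  "atype m i = (if i < m then Fwd i else if i < 2 * m then Bwd (i - m) else Edg (i - 2 * m))"

lemma atype_inj: "atype m i = atype m j \<longleftrightarrow> i = j"
  by (auto simp: atype_def)

lemma atype_valid:
  assumes "i < 2 * m + n" and "t = atype m i \<or> t = flip_adj (atype m i)"
  shows "t = Fwd k \<Longrightarrow> k < m" "t = Edg k \<Longrightarrow> k < n"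
  using assms by (auto simp: atype_def split: if_splits)

text \<open>Vertex \<open>0\<close> is joined to everything. The vertices \<open>1, \<dots>, p (3 p + 1)\<close> form \<open>p\<close> consecutive blocks
  of \<open>3 p + 1\<close>; block \<open>t\<close> has type \<open>t\<close> towards \<open>0\<close>, its first vertex is a hub that sends each type to three
  consecutive vertices, and each such triple induces a special 2-path.\<close>

definition fan_lab :: "nat \<Rightarrow> nat \<Rightarrow> nat \<Rightarrow> nat \<Rightarrow> adjtype option" where
  "fan_lab m p a b = (let q = 3 * p + 1; i = (b - 1) mod q - 1 in
     if b = 0 \<or> p * q < b then None
     else if a = 0 then Some (atype m ((b - 1) div q))
     else if (a - 1) div q \<noteq> (b - 1) div q then None
     else if (a - 1) mod q = 0 then Some (atype m (i div 3))
     else if b \<noteq> a + 1 \<or> i mod 3 = 0 then None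
     else if i mod 3 = 1 then Some (flip_adj (atype m 0))
     else Some (atype m 1))"

definition fan_graph :: "nat \<Rightarrow> nat \<Rightarrow> mgraph" where
  "fan_graph m p = \<lparr>verts = {0..p * (3 * p + 1)}, lab = (\<lambda>a b.
     if a < b then fan_lab m p a b else if b < a then map_option flip_adj (fan_lab m p b a) else None)\<rparr>"

context
  fixes m n p :: nat
  assumes p: "p = 2 * m + n" "p > 1"
begin

lemma fan_lab_eq:
  assumes "q = 3 * p + 1"
  shows "fan_lab m p a b = (if b = 0 \<or> p * q < b then None
     else if a = 0 then Some (atype m ((b - 1) div q))
     else if (a - 1) div q \<noteq> (b - 1) div q then None
     else if (a - 1) mod q = 0 then Some (atype m (((b - 1) mod q - 1) div 3))
     else if b \<noteq> a + 1 \<or> ((b - 1) mod q - 1) mod 3 = 0 then None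
     else if ((b - 1) mod q - 1) mod 3 = 1 then Some (flip_adj (atype m 0))
     else Some (atype m 1))"
  unfolding fan_lab_def Let_def assms by (rule refl)

lemma fan_lab_Some:
  assumes t: "fan_lab m p a b = Some t" "a < b" and q: "q = 3 * p + 1"
  shows "b \<le> p * q" "\<exists>i<p. t = atype m i \<or> t = flip_adj (atype m i)"
    and "a = 0 \<or> (a - 1) div q = (b - 1) div q \<and> ((a - 1) mod q = 0 \<or> b = a + 1)"
proof -
  note t' = t(1)[unfolded fan_lab_eq[OF q]]
  have b: "b \<noteq> 0" "b \<le> p * q"
    using t' by (auto split: if_splits)
  show "b \<le> p * q" by (rule b)
  show "a = 0 \<or> (a - 1) div q = (b - 1) div q \<and> ((a - 1) mod q = 0 \<or> b = a + 1)"
    using t' by (auto split: if_splits)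
  have "t = atype m ((b - 1) div q) \<or> t = atype m (((b - 1) mod q - 1) div 3) \<or> t = flip_adj (atype m 0) \<or> t = atype m 1"
    using t' by (auto split: if_splits)
  moreover have "(b - 1) div q < p"
    using b q by (simp add: div_less_iff_less_mult)
  \<comment> \<open>Offsets within a block run up to \<open>3 * p\<close>; subtracting one for the
    hub leaves \<open>p\<close> triples.\<close>
  moreover have "((b - 1) mod q - 1) div 3 < p"
  proof -
    have "(b - 1) mod q < q" using q by simp
    then have "(b - 1) mod q - 1 < p * 3" using p(2) q by linarith
    then show ?thesis by (simp add: div_less_iff_less_mult)
  qed
  moreover have "0 < p" "1 < p" using p by auto
  ultimately show "\<exists>i<p. t = atype m i \<or> t = flip_adj (atype m i)" by blast
qed

lemma fan_graph_colored: "colored_mixed_graph m n (fan_graph m p)"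
  unfolding colored_mixed_graph_def
proof (intro conjI allI impI)
  show "finite (verts (fan_graph m p))" by (simp add: fan_graph_def)
  fix u v
  show "lab (fan_graph m p) v u = map_option flip_adj (lab (fan_graph m p) u v)"
    by (auto simp: fan_graph_def option.map_comp comp_def option.map_ident)
  have lt: "a \<le> p * (3 * p + 1)" "b \<le> p * (3 * p + 1)" if "fan_lab m p a b \<noteq> None" "a < b" for a b
    using fan_lab_Some(1)[of a b _ "3 * p + 1"] that by auto
  show "u \<in> verts (fan_graph m p)" "v \<in> verts (fan_graph m p)" "u \<noteq> v" if "lab (fan_graph m p) u v \<noteq> None"
    using that lt[of u v] lt[of v u] by (auto simp: fan_graph_def split: if_splits)
  have val: "\<exists>i<p. t = atype m i \<or> t = flip_adj (atype m i)" if t: "lab (fan_graph m p) u v = Some t" for t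
  proof (cases "u < v")
    case True
    then show ?thesis using t fan_lab_Some(2)[of u v t "3 * p + 1"] by (simp add: fan_graph_def)
  next
    case False
    then obtain s where "v < u" "fan_lab m p v u = Some s" "t = flip_adj s"
      using t by (auto simp: fan_graph_def split: if_splits)
    then show ?thesis using fan_lab_Some(2)[of v u s "3 * p + 1"] by auto
  qed
  show "i < m" if "lab (fan_graph m p) u v = Some (Fwd i)" for i
    using val[OF that] atype_valid(1)[of _ m n] p(1) by blast
  show "j < n" if "lab (fan_graph m p) u v = Some (Edg j)" for j
    using val[OF that] atype_valid(2)[of _ m n] p(1) by blast
qed

lemma fan_graph_planar: "planar (verts (fan_graph m p)) (underlying_edges (fan_graph m p))"
proof -
  define q where "q = 3 * p + 1"
  define C where "C = {(a, b). 1 \<le> a \<and> a < b \<and> fan_lab m p a b \<noteq> None}"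
  have C: "1 \<le> a \<and> a < b \<and> b \<le> p * q \<and> (a - 1) div q = (b - 1) div q \<and> ((a - 1) mod q = 0 \<or> b = a + 1)"
    if "(a, b) \<in> C" for a b
    using that fan_lab_Some(1,3)[of a b _ q] by (auto simp: C_def q_def)
  have spoke: "fan_lab m p 0 k \<noteq> None \<longleftrightarrow> k \<le> p * q" if "1 \<le> k" for k
    using that by (auto simp: fan_lab_def Let_def q_def)
  have eq: "underlying_edges (fan_graph m p) = {{0, k} | k. 1 \<le> k \<and> k \<le> p * q} \<union> {{a, b} | a b. (a, b) \<in> C}"
  proof (intro equalityI subsetI)
    fix e assume "e \<in> underlying_edges (fan_graph m p)"
    then obtain u v where e: "e = {u, v}" and "lab (fan_graph m p) u v \<noteq> None" by (auto simp: underlying_edges_def)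
    then have "u < v \<and> fan_lab m p u v \<noteq> None \<or> v < u \<and> fan_lab m p v u \<noteq> None"
      by (auto simp: fan_graph_def split: if_splits)
    then obtain a b where ab: "e = {a, b}" "a < b" "fan_lab m p a b \<noteq> None"
      using e by (auto simp: insert_commute)
    show "e \<in> {{0, k} | k. 1 \<le> k \<and> k \<le> p * q} \<union> {{a, b} | a b. (a, b) \<in> C}"
    proof (cases "a = 0")
      case True
      then have "1 \<le> b" "b \<le> p * q" using ab spoke[of b] by auto
      then show ?thesis using ab True by blast
    next
      case False
      then have "(a, b) \<in> C" using ab by (auto simp: C_def)
      then show ?thesis using ab by blast
    qed
  next
    fix e assume "e \<in> {{0, k} | k. 1 \<le> k \<and> k \<le> p * q} \<union> {{a, b} | a b. (a, b) \<in> C}"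
    then obtain a b where ab: "e = {a, b}" "a < b" "fan_lab m p a b \<noteq> None"
      using spoke by (fastforce simp: C_def)
    then have "lab (fan_graph m p) a b \<noteq> None" by (simp add: fan_graph_def)
    then show "e \<in> underlying_edges (fan_graph m p)" using ab by (auto simp: underlying_edges_def)
  qed
  have "\<not> (a < c \<and> c < b \<and> b < d)" if ab: "(a, b) \<in> C" and cd: "(c, d) \<in> C" for a b c d
  proof
    assume lt: "a < c \<and> c < b \<and> b < d"
    note A = C[OF ab] and D = C[OF cd]
    \<comment> \<open>Two crossing edges would lie in one block, and neither would join consecutive
      vertices; both would then start at the hub of that block.\<close>
    have "(a - 1) div q \<le> (c - 1) div q" "(c - 1) div q \<le> (b - 1) div q"
      using lt by (auto intro!: div_le_mono)
    then have "(c - 1) div q = (a - 1) div q" using A by linarith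
    moreover have "(a - 1) mod q = 0" "(c - 1) mod q = 0" using A D lt by auto
    ultimately have "a - 1 = c - 1" by (metis div_mult_mod_eq)
    then show False using A lt by linarith
  qed
  then have "planar {0..p * q} (underlying_edges (fan_graph m p))"
    unfolding eq by (intro planar_apex_over_noncrossing_chords) (use C in blast)+
  then show ?thesis by (simp add: fan_graph_def q_def)
qed

lemma fan_graph_relative_clique: "relative_clique m n (fan_graph m p) (verts (fan_graph m p))"
proof (rule relative_cliqueI[OF fan_graph_colored order_refl])
  define q where "q = 3 * p + 1"
  fix u v assume "u \<in> verts (fan_graph m p)" "v \<in> verts (fan_graph m p)" and uv: "u < v"
  then have N: "u \<le> p * q" "v \<le> p * q" by (auto simp: fan_graph_def q_def)
  have up: "lab (fan_graph m p) a b = fan_lab m p a b" if "a < b" for a b using that by (simp add: fan_graph_def)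
  have down: "lab (fan_graph m p) b a = map_option flip_adj (fan_lab m p a b)" if "a < b" for a b using that by (simp add: fan_graph_def)
  have zero: "fan_lab m p 0 b = Some (atype m ((b - 1) div q))" if "1 \<le> b" "b \<le> p * q" for b
    using that by (simp add: fan_lab_def Let_def q_def)
  note fl = fan_lab_eq[OF q_def]
  have block: "fan_lab m p (t * q + 1) (t * q + 1 + i) = Some (atype m ((i - 1) div 3))"
    if "1 \<le> i" "i < q" "t * q + 1 + i \<le> p * q" for t i
  proof -
    have "t * q + 1 + i - 1 = t * q + i" "t * q + 1 - 1 = t * q" by auto
    moreover have "(t * q + i) div q = t" "(t * q + i) mod q = i" "t * q div q = t" "t * q mod q = 0"
      using that by simp_all
    ultimately show ?thesis unfolding fl using that by simp
  qed
  have succ: "fan_lab m p (t * q + 1 + i) (t * q + 1 + Suc i) =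
      (if i mod 3 = 0 then None else if i mod 3 = 1 then Some (flip_adj (atype m 0)) else Some (atype m 1))"
    if "1 \<le> i" "Suc i < q" "t * q + 1 + Suc i \<le> p * q" for t i
  proof -
    have "t * q + 1 + i - 1 = t * q + i" "t * q + 1 + Suc i - 1 = t * q + Suc i" by auto
    moreover have "(t * q + i) div q = t" "(t * q + i) mod q = i" "(t * q + Suc i) div q = t" "(t * q + Suc i) mod q = Suc i"
      using that by (simp_all del: add_Suc_right)
    ultimately show ?thesis unfolding fl using that by simp
  qed
  show "lab (fan_graph m p) u v \<noteq> None \<or>
    (\<exists>w. lab (fan_graph m p) w u \<noteq> None \<and> lab (fan_graph m p) w v \<noteq> None \<and> lab (fan_graph m p) w u \<noteq> lab (fan_graph m p) w v)"
  proof (cases "u = 0")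
    case True
    then show ?thesis using up[OF uv] zero[of v] N uv by simp
  next
    case False
    \<comment> \<open>Coordinates as block and offset; offset 0 is the hub of the block.\<close>
    define s t i j where "s = (u - 1) div q" and "t = (v - 1) div q" and "i = (u - 1) mod q" and "j = (v - 1) mod q"
    have u: "u = s * q + 1 + i" and v: "v = t * q + 1 + j"
      using False uv div_mult_mod_eq[of "u - 1" q] div_mult_mod_eq[of "v - 1" q]
      by (simp_all add: s_def t_def i_def j_def)
    have ij: "i < q" "j < q" by (simp_all add: i_def j_def q_def)
    show ?thesis
    proof (cases "s = t")
      case False
      have "lab (fan_graph m p) 0 u = Some (atype m s)" "lab (fan_graph m p) 0 v = Some (atype m t)"
        using up[of 0] zero N \<open>u \<noteq> 0\<close> uv by (simp_all add: s_def t_def)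
      then show ?thesis using False atype_inj by (intro disjI2 exI[of _ 0]) simp
    next
      case True
      then have lt: "i < j" using u v uv by simp
      show ?thesis
      proof (cases "i = 0")
        case True
        then have "fan_lab m p u v \<noteq> None" using block[of j t] lt ij u v \<open>s = t\<close> N by simp
        then show ?thesis using up[OF uv] by simp
      next
        case False
        let ?z = "t * q + 1"
        have zu: "lab (fan_graph m p) ?z u = Some (atype m ((i - 1) div 3))"
          using up[of ?z u] block[of i t] False ij u \<open>s = t\<close> N by simp
        have zv: "lab (fan_graph m p) ?z v = Some (atype m ((j - 1) div 3))"
          using up[of ?z v] block[of j t] lt ij v N by simp
        show ?thesis
        proof (cases "(i - 1) div 3 = (j - 1) div 3")
          case False
          then show ?thesis using zu zv atype_inj by (intro disjI2 exI[of _ ?z]) simp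
        next
          case True
          \<comment> \<open>Both vertices lie in triple \<open>k\<close>, at positions
            \<open>r\<close> and \<open>r'\<close>; as \<open>r < r'\<close>, three cases remain,
            and only the two ends of the triple are not adjacent.\<close>
          define k r r' where "k = (i - 1) div 3" and "r = (i - 1) mod 3" and "r' = (j - 1) mod 3"
          have "i = 3 * k + r + 1" "j = 3 * k + r' + 1"
            using False lt True mult_div_mod_eq[of 3 "i - 1"] mult_div_mod_eq[of 3 "j - 1"]
            by (simp_all add: k_def r_def r'_def)
          moreover have "r < 3" "r' < 3" by (simp_all add: r_def r'_def)
          ultimately have "r = 0 \<and> r' = 1 \<or> r = 1 \<and> r' = 2 \<or> r = 0 \<and> r' = 2" using lt by linarith
          then have "j = i + 1 \<and> i mod 3 \<noteq> 0 \<or> j = i + 2 \<and> i mod 3 = 1"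
            using \<open>i = 3 * k + r + 1\<close> \<open>j = 3 * k + r' + 1\<close> by (elim disjE conjE) (simp_all add: mod_Suc)
          then show ?thesis
          proof (elim disjE conjE)
            assume j: "j = i + 1" "i mod 3 \<noteq> 0"
            then have "fan_lab m p u v \<noteq> None" using succ[of i t] False ij u v \<open>s = t\<close> N by simp
            then show ?thesis using up[OF uv] by simp
          next
            assume j: "j = i + 2" "i mod 3 = 1"
            \<comment> \<open>The middle vertex sees \<open>u\<close> with type 0, whose flip is
              stored for the pair from \<open>u\<close> to \<open>?w\<close>, and sees
              \<open>v\<close> with type 1; both types exist because \<open>p > 1\<close>.\<close>
            let ?w = "t * q + 1 + Suc i"
            have "fan_lab m p u ?w = Some (flip_adj (atype m 0))"
              using succ[of i t] False ij u v \<open>s = t\<close> N j by simp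
            then have "lab (fan_graph m p) ?w u = Some (atype m 0)" using down[of u ?w] u \<open>s = t\<close> by simp
            moreover have "Suc i mod 3 = 2" using j(2) by (simp add: mod_Suc)
            then have "fan_lab m p ?w v = Some (atype m 1)"
              using succ[of "Suc i" t] ij v N j by simp
            then have "lab (fan_graph m p) ?w v = Some (atype m 1)" using up[of ?w v] v j by simp
            ultimately show ?thesis using atype_inj[of m 0 1] by (intro disjI2 exI[of _ ?w]) simp
          qed
        qed
      qed
    qed
  qed
qed

end

theorem mainTheorem4:
  fixes m n p :: nat
  assumes "p = 2 * m + n" and "p > 1"
  shows "enat (3 * p^2 + p + 1) \<le> omega_r_planar m n \<and> omega_r_planar m n \<le> enat (42 * p^2 + 8)"
proof
  let ?\<G> = "{G. colored_mixed_graph m n G \<and> planar (verts G) (underlying_edges G)}"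
  \<comment> \<open>\<open>Max\<close> in \<open>omega_r\<close> is meaningful only for a finite
    nonempty set; further down, the empty clique supplies nonemptiness.\<close>
  have fin: "finite {card R | R. relative_clique m n G R}" if "colored_mixed_graph m n G" for G
  proof -
    have "{card R | R. relative_clique m n G R} \<subseteq> card ` Pow (verts G)" by (auto simp: relative_clique_def)
    then show ?thesis using colored_mixed_graphD(1)[OF that] by (meson finite_Pow_iff finite_imageI finite_subset)
  qed
  let ?F = "fan_graph m p"
  have F: "?F \<in> ?\<G>" using fan_graph_colored[OF assms] fan_graph_planar[OF assms] by blast
  have "card (verts ?F) = 3 * p^2 + p + 1"
    by (simp add: fan_graph_def power2_eq_square algebra_simps)
  then have "3 * p^2 + p + 1 \<le> omega_r m n ?F"
    unfolding omega_r_def using fan_graph_relative_clique[OF assms] fin[OF fan_graph_colored[OF assms]]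
    by (intro Max_ge) (auto intro!: exI[of _ "verts ?F"])
  then show "enat (3 * p^2 + p + 1) \<le> omega_r_planar m n"
    unfolding omega_r_planar_def using SUP_upper2[OF F] by (metis enat_ord_simps(1))
  have "omega_r m n G \<le> 42 * p^2 + 8" if "G \<in> ?\<G>" for G
  proof -
    have G: "colored_mixed_graph m n G" "planar (verts G) (underlying_edges G)" using that by auto
    have "relative_clique m n G {}" by (simp add: relative_clique_def)
    then have "{card R | R. relative_clique m n G R} \<noteq> {}" by blast
    then show ?thesis
      unfolding omega_r_def using fin[OF G(1)] planar_relative_clique_bound[OF G _ assms]
      by (subst Max_le_iff) auto
  qed
  then show "omega_r_planar m n \<le> enat (42 * p^2 + 8)"
    unfolding omega_r_planar_def by (intro SUP_least) auto
qed

end
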